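(* For every equivalence relation $\equiv$ on graphs that is finer than $\equiv^{1}_{\mathrm{C}}$ and coarser than $\equiv^{k}_{\mathrm{C}}$ for some integer $k\geq 2$, there is no class $\mathscr{F}$ of graphs such that for every two graphs $G$ and $H$, we have that $G\equiv H$ if and only if $\hom(G,\mathscr{F})=\hom(H,\mathscr{F})$.
   Context: All graphs are finite, undirected and simple (no self-loops, no multi-edges). A class of graphs means a non-empty collection of graphs closed under isomorphism. A homomorphism from $G$ to $H$ is a map $h:V(G)\to V(H)$ such that $(u,v)\in E(G)$ implies $(h(u),h(v))\in E(H)$; $\hom(G,H)$ denotes the number of homomorphisms from $G$ to $H$. For a class $\mathscr{F}$ of graphs, $\hom(G,\mathscr{F})=(\hom(G,F)\mid F\in\mathscr{F})$ is the right profile of $G$ restricted to $\mathscr{F}$; thus $\hom(G,\mathscr{F})=\hom(H,\mathscr{F})$ means $\hom(G,F)=\hom(H,F)$ for every $F\in\mathscr{F}$. Counting logics: for $k\ge 1$, $\mathrm{C}^k$ is the logic obtained from the fragment of first-order logic (with equality, over the vocabulary with one binary relation symbol $E$ for the edge relation) consisting of formulas with at most $k$ distinct variables, by augmenting the syntax with all counting quantifiers $\exists i\,x$, $i\geq 1$, where $\exists i\,x\,\varphi(x)$ means that there are at least $i$ distinct elements $x$ satisfying $\varphi(x)$. We write $G\equiv^k_{\mathrm{C}}H$ if $G$ and $H$ satisfy the same $\mathrm{C}^k$-sentences. An equivalence relation $\equiv$ is finer than $\equiv'$ (and $\equiv'$ is coarser than $\equiv$) if $G\equiv H$ implies $G\equiv'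 H$ (not necessarily strictly). So the hypothesis is: $G\equiv^k_{\mathrm{C}}H$ implies $G\equiv H$, and $G\equiv H$ implies $G\equiv^1_{\mathrm{C}}H$. *)

theory Defs
  imports "Graph_Theory.Graph_Theory" "HOL-Library.FuncSet"
begin

text \<open>
  A finite simple undirected graph is a \<^locale>\<open>pair_graph\<close>: a finite, symmetric, loop-free digraph
  whose arcs are pairs of vertices.  The vertices are natural numbers, so up to isomorphism
  every finite graph occurs.
\<close>

definition graphs :: "nat pair_pre_digraph set" where
  "graphs = {G. pair_graph G}"

definition graph_class :: "nat pair_pre_digraph set \<Rightarrow> bool" where
  "graph_class \<F> \<longleftrightarrow> \<F> \<noteq> {} \<and> \<F> \<subseteq> graphs \<and>
     (\<forall>F \<in> \<F>. \<forall>F' \<in> graphs. digraph_iso (with_proj F) (with_proj F') \<longrightarrow> F' \<in> \<F>)"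

text \<open>
  Homomorphisms are taken to be extensional, so that two of them are equal iff they agree on the
  vertices of the source.
\<close>

definition graph_homs :: "'a pair_pre_digraph \<Rightarrow> 'b pair_pre_digraph \<Rightarrow> ('a \<Rightarrow> 'b) set" where
  "graph_homs G H = {h \<in> pverts G \<rightarrow>\<^sub>E pverts H.
     \<forall>u v. (u, v) \<in> parcs G \<longrightarrow> (h u, h v) \<in> parcs H}"

definition hom_count :: "'a pair_pre_digraph \<Rightarrow> 'b pair_pre_digraph \<Rightarrow> nat" where
  "hom_count G H = card (graph_homs G H)"

definition same_right_profile ::
    "'b pair_pre_digraph set \<Rightarrow> 'a pair_pre_digraph \<Rightarrow> 'a pair_pre_digraph \<Rightarrow> bool" where
  "same_right_profile \<F> G H \<longleftrightarrow> (\<forall>F \<in> \<F>. hom_count G F = hom_count H F)"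

datatype cfm =
    Eq nat nat
  | Edge nat nat
  | Neg cfm
  | Conj cfm cfm
  | Disj cfm cfm
  | Exists nat cfm
  | Forall nat cfm
  | AtLeast nat nat cfm  \<comment> \<open>\<open>AtLeast i x \<phi>\<close> is the counting quantifier \<open>\<exists>i x. \<phi>\<close>\<close>

fun all_vars :: "cfm \<Rightarrow> nat set" where
  "all_vars (Eq x y) = {x, y}"
| "all_vars (Edge x y) = {x, y}"
| "all_vars (Neg \<phi>) = all_vars \<phi>"
| "all_vars (Conj \<phi> \<psi>) = all_vars \<phi> \<union> all_vars \<psi>"
| "all_vars (Disj \<phi> \<psi>) = all_vars \<phi> \<union> all_vars \<psi>"
| "all_vars (Exists x \<phi>) = insert x (all_vars \<phi>)"
| "all_vars (Forall x \<phi>) = insert x (all_vars \<phi>)"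
| "all_vars (AtLeast i x \<phi>) = insert x (all_vars \<phi>)"

fun free_vars :: "cfm \<Rightarrow> nat set" where
  "free_vars (Eq x y) = {x, y}"
| "free_vars (Edge x y) = {x, y}"
| "free_vars (Neg \<phi>) = free_vars \<phi>"
| "free_vars (Conj \<phi> \<psi>) = free_vars \<phi> \<union> free_vars \<psi>"
| "free_vars (Disj \<phi> \<psi>) = free_vars \<phi> \<union> free_vars \<psi>"
| "free_vars (Exists x \<phi>) = free_vars \<phi> - {x}"
| "free_vars (Forall x \<phi>) = free_vars \<phi> - {x}"
| "free_vars (AtLeast i x \<phi>) = free_vars \<phi> - {x}"

fun positive_counts :: "cfm \<Rightarrow> bool" where
  "positive_counts (Eq x y) = True"
| "positive_counts (Edge x y) = True"
| "positive_counts (Neg \<phi>) = positive_counts \<phi>"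
| "positive_counts (Conj \<phi> \<psi>) = (positive_counts \<phi> \<and> positive_counts \<psi>)"
| "positive_counts (Disj \<phi> \<psi>) = (positive_counts \<phi> \<and> positive_counts \<psi>)"
| "positive_counts (Exists x \<phi>) = positive_counts \<phi>"
| "positive_counts (Forall x \<phi>) = positive_counts \<phi>"
| "positive_counts (AtLeast i x \<phi>) = (i \<ge> 1 \<and> positive_counts \<phi>)"

fun sat :: "'a pair_pre_digraph \<Rightarrow> (nat \<Rightarrow> 'a) \<Rightarrow> cfm \<Rightarrow> bool" where
  "sat G \<alpha> (Eq x y) = (\<alpha> x = \<alpha> y)"
| "sat G \<alpha> (Edge x y) = ((\<alpha> x, \<alpha> y) \<in> parcs G)"
| "sat G \<alpha> (Neg \<phi>) = (\<not> sat G \<alpha> \<phi>)"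
| "sat G \<alpha> (Conj \<phi> \<psi>) = (sat G \<alpha> \<phi> \<and> sat G \<alpha> \<psi>)"
| "sat G \<alpha> (Disj \<phi> \<psi>) = (sat G \<alpha> \<phi> \<or> sat G \<alpha> \<psi>)"
| "sat G \<alpha> (Exists x \<phi>) = (\<exists>v \<in> pverts G. sat G (\<alpha>(x := v)) \<phi>)"
| "sat G \<alpha> (Forall x \<phi>) = (\<forall>v \<in> pverts G. sat G (\<alpha>(x := v)) \<phi>)"
| "sat G \<alpha> (AtLeast i x \<phi>) = (i \<le> card {v \<in> pverts G. sat G (\<alpha>(x := v)) \<phi>})"

definition C_sentence :: "nat \<Rightarrow> cfm \<Rightarrow> bool" where
  "C_sentence k \<phi> \<longleftrightarrow> positive_counts \<phi> \<and> card (all_vars \<phi>) \<le> k \<and> free_vars \<phi> = {}"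

text \<open>
  The truth value of a sentence does not depend on the assignment.  Assignments are not required
  to take values in the vertex set, as no such assignment exists for the graph without vertices.
\<close>

definition models :: "'a pair_pre_digraph \<Rightarrow> cfm \<Rightarrow> bool" where
  "models G \<phi> \<longleftrightarrow> (\<forall>\<alpha>. sat G \<alpha> \<phi>)"

definition C_equiv :: "nat \<Rightarrow> 'a pair_pre_digraph \<Rightarrow> 'b pair_pre_digraph \<Rightarrow> bool" where
  "C_equiv k G H \<longleftrightarrow> (\<forall>\<phi>. C_sentence k \<phi> \<longrightarrow> (models G \<phi> \<longleftrightarrow> models H \<phi>))"

end

theory Submission
  imports Defs
begin

text \<open>
  Suppose that the right profile over a class \<open>\<F>\<close> characterises \<open>R\<close>.

  Some \<open>F\<close> in \<open>\<F>\<close> has vertices \<open>a\<close> and \<open>b\<close> with a common neighbour but different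
  neighbourhoods.  Otherwise, no triangle maps to any \<open>F\<close> in \<open>\<F>\<close>: two vertices of its image would
  have the same neighbourhood and be adjacent, which makes a loop.  Then the complete graphs on
  three and on four vertices have the same (zero) profile, although \<open>C\<^sup>1\<close> distinguishes them by
  counting vertices.

  Such an \<open>F\<close> separates two \<open>C\<^sup>k\<close>-equivalent graphs, the untwisted and the twisted graph of Cai,
  Fuerer and Immerman over the hypercube of an even dimension \<open>d \<ge> k\<close>.  Each edge of the cube
  becomes a pair of \<^emph>\<open>link\<close> vertices, and each vertex of the cube becomes the set of \<^emph>\<open>core\<close>
  vertices that choose one link per incident edge, an even number of times the second one.  The
  twist changes the parity at one cube vertex.

  \<^item> The graphs are \<open>C\<^sup>k\<close>-equivalent (\<open>cfi_graphs_C_equiv\<close>).  In the bijective pebble game,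
    Duplicator keeps the twist at a cube vertex without pebbled core vertices.  When Spoiler moves
    there, fewer than \<open>k \<le> d\<close> pebbles lie on the board, each blocks at most one of the \<open>d\<close>
    directions, and so the twist can escape along a free edge.

  \<^item> They have different numbers of homomorphisms to \<open>F\<close> (\<open>hom_count_cfi_graphs_differ\<close>).  Once the
    images of the links are fixed, the core vertices are mapped independently, so the number of
    homomorphisms is a sum, over assignments to the edges of the cube, of a product of local
    tensors.  Exchanging the two links of an edge exchanges the parities at its ends.  Therefore,
    up to a positive factor, the difference of the two sums is the contraction, along the cube, of
    the difference \<open>\<Psi>\<close> of the local tensors for even and odd parity.  Glueing two copies of a
    partial contraction along one direction of the cube gives, on the diagonal, a sum of squares;
    by induction over the directions, the whole contraction does not vanish unless \<open>\<Psi> = 0\<close>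
    (\<open>cube_sums_differ\<close>).

  \<^item> The tensor \<open>\<Psi>\<close> is not zero where every pair of links is mapped to \<open>(a, b)\<close>.  All but two core
    vertices then see both \<open>a\<close> and \<open>b\<close> and have \<open>m = |N(a) \<inter> N(b)|\<close> possible images; the two
    constant choices have \<open>|N(a)|\<close> and \<open>|N(b)|\<close>.  As \<open>d\<close> is even, both of these are even, and
    \<open>|N(a)| |N(b)| > m\<^sup>2\<close> (\<open>core_tensor_parities_differ\<close>).
\<close>

section \<open>Bijective pebble games\<close>

lemma pair_graph_iff:
  "pair_graph G \<longleftrightarrow>
     finite (pverts G) \<and> parcs G \<subseteq> pverts G \<times> pverts G \<and> sym (parcs G) \<and> irrefl (parcs G)"
proof
  assume "pair_graph G"
  then interpret pair_graph G .
  show "finite (pverts G) \<and> parcs G \<subseteq> pverts G \<times> pverts G \<and> sym (parcs G) \<and> irrefl (parcs G)"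
    using pair_finite_verts arc_fst_in_verts arc_snd_in_verts pair_no_loops pair_sym_arcs
    by (fastforce simp: symmetric_def irrefl_def)
next
  assume *: "finite (pverts G) \<and> parcs G \<subseteq> pverts G \<times> pverts G \<and> sym (parcs G) \<and> irrefl (parcs G)"
  then have "finite (parcs G)"
    using finite_subset by blast
  with * show "pair_graph G"
    by unfold_locales (auto simp: symmetric_def irrefl_def)
qed

lemma finite_all_vars: "finite (all_vars \<phi>)"
  by (induction \<phi>) auto

lemma free_vars_subset_all_vars: "free_vars \<phi> \<subseteq> all_vars \<phi>"
  by (induction \<phi>) auto

lemma bij_betw_ball_iff:
  assumes "bij_betw p A B" and "\<And>w. w \<in> A \<Longrightarrow> Q w \<longleftrightarrow> R (p w)"
  shows "(\<forall>w\<in>A. Q w) \<longleftrightarrow> (\<forall>w\<in>B. R w)"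
  using assms by (auto simp: bij_betw_def)

lemma bij_betw_card_filter:
  assumes "bij_betw p A B" and "\<And>w. w \<in> A \<Longrightarrow> Q w \<longleftrightarrow> R (p w)"
  shows "card {w \<in> A. Q w} = card {w \<in> B. R w}"
proof (rule bij_betw_same_card)
  show "bij_betw p {w \<in> A. Q w} {w \<in> B. R w}"
    using assms by (auto simp: bij_betw_def inj_on_def)
qed

text \<open>
  The invariant \<open>I P \<alpha> \<beta>\<close> describes the positions from which Duplicator can go on when the pebbles
  in \<open>P\<close> lie on the board.  Only the values of \<open>\<alpha>\<close> and \<open>\<beta>\<close> on \<open>P\<close> are meant to matter.  Lifting the
  pebble of the quantified variable leaves fewer than \<open>k\<close> pebbles, whence the bound in the move;
  the bijection matches the witnesses of a quantifier one to one, which preserves their number.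
\<close>

lemma bijective_game_sat:
  fixes G :: "'a pair_pre_digraph" and H :: "'b pair_pre_digraph"
    and I :: "nat set \<Rightarrow> (nat \<Rightarrow> 'a) \<Rightarrow> (nat \<Rightarrow> 'b) \<Rightarrow> bool"
  assumes eq: "\<And>P \<alpha> \<beta> x y. I P \<alpha> \<beta> \<Longrightarrow> x \<in> P \<Longrightarrow> y \<in> P \<Longrightarrow> \<alpha> x = \<alpha> y \<longleftrightarrow> \<beta> x = \<beta> y"
    and arcs: "\<And>P \<alpha> \<beta> x y. I P \<alpha> \<beta> \<Longrightarrow> x \<in> P \<Longrightarrow> y \<in> P \<Longrightarrow>
                 (\<alpha> x, \<alpha> y) \<in> parcs G \<longleftrightarrow> (\<beta> x, \<beta> y) \<in> parcs H"
    and mono: "\<And>P Q \<alpha> \<beta>. I P \<alpha> \<beta> \<Longrightarrow> Q \<subseteq> P \<Longrightarrow> I Q \<alpha> \<beta>"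
    and move: "\<And>P \<alpha> \<beta> x. I P \<alpha> \<beta> \<Longrightarrow> finite P \<Longrightarrow> card P < k \<Longrightarrow> x \<notin> P \<Longrightarrow>
                 \<exists>p. bij_betw p (pverts G) (pverts H) \<and>
                     (\<forall>w\<in>pverts G. I (insert x P) (\<alpha>(x := w)) (\<beta>(x := p w)))"
  shows "card (all_vars \<phi>) \<le> k \<Longrightarrow> I (free_vars \<phi>) \<alpha> \<beta> \<Longrightarrow> sat G \<alpha> \<phi> \<longleftrightarrow> sat H \<beta> \<phi>"
proof (induction \<phi> arbitrary: \<alpha> \<beta>)
  case (Eq x y)
  then show ?case using eq[of "{x, y}"] by simp
next
  case (Edge x y)
  then show ?case using arcs[of "{x, y}"] by simp
next
  case (Neg \<phi>)
  then show ?case by simp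
next
  case (Conj \<phi> \<psi>)
  have "card (all_vars \<phi>) \<le> k" "card (all_vars \<psi>) \<le> k"
    using Conj.prems(1) card_mono[of "all_vars \<phi> \<union> all_vars \<psi>"] finite_all_vars
    by (metis all_vars.simps(4) finite_Un le_trans sup_ge1, metis all_vars.simps(4) finite_Un le_trans sup_ge2)
  moreover have "I (free_vars \<phi>) \<alpha> \<beta>" "I (free_vars \<psi>) \<alpha> \<beta>"
    using Conj.prems(2) mono by (metis free_vars.simps(4) sup_ge1, metis free_vars.simps(4) sup_ge2)
  ultimately show ?case using Conj.IH by simp
next
  case (Disj \<phi> \<psi>)
  have "card (all_vars \<phi>) \<le> k" "card (all_vars \<psi>) \<le> k"
    using Disj.prems(1) card_mono[of "all_vars \<phi> \<union> all_vars \<psi>"] finite_all_vars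
    by (metis all_vars.simps(5) finite_Un le_trans sup_ge1, metis all_vars.simps(5) finite_Un le_trans sup_ge2)
  moreover have "I (free_vars \<phi>) \<alpha> \<beta>" "I (free_vars \<psi>) \<alpha> \<beta>"
    using Disj.prems(2) mono by (metis free_vars.simps(5) sup_ge1, metis free_vars.simps(5) sup_ge2)
  ultimately show ?case using Disj.IH by simp
next
  \<comment> \<open>The three quantifiers only need that a bijection matches the witnesses.\<close>
  have quantifier:
    "\<exists>p. bij_betw p (pverts G) (pverts H) \<and>
         (\<forall>w\<in>pverts G. sat G (\<alpha>(x := w)) \<phi> \<longleftrightarrow> sat H (\<beta>(x := p w)) \<phi>)"
    if IH: "\<And>\<alpha> \<beta>. card (all_vars \<phi>) \<le> k \<Longrightarrow> I (free_vars \<phi>) \<alpha> \<beta> \<Longrightarrow> sat G \<alpha> \<phi> \<longleftrightarrow> sat H \<beta> \<phi>"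
      and card: "card (insert x (all_vars \<phi>)) \<le> k"
      and inv: "I (free_vars \<phi> - {x}) \<alpha> \<beta>" for x \<phi> \<alpha> \<beta>
  proof -
    have fin: "finite (free_vars \<phi> - {x})"
      using finite_subset[OF free_vars_subset_all_vars finite_all_vars] by blast
    have "card (free_vars \<phi> - {x}) < card (insert x (all_vars \<phi>))"
      using free_vars_subset_all_vars[of \<phi>] finite_all_vars[of \<phi>]
      by (intro psubset_card_mono) auto
    with card have "card (free_vars \<phi> - {x}) < k"
      by simp
    from move[OF inv fin this, of x] obtain p where
      p: "bij_betw p (pverts G) (pverts H)"
         "\<forall>w\<in>pverts G. I (insert x (free_vars \<phi> - {x})) (\<alpha>(x := w)) (\<beta>(x := p w))"
      by blast
    have "card (all_vars \<phi>) \<le> k"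
      using card card_mono[of "insert x (all_vars \<phi>)" "all_vars \<phi>"] finite_all_vars[of \<phi>]
      by (simp add: subset_insertI)
    then show ?thesis
      using p IH mono[of "insert x (free_vars \<phi> - {x})" _ _ "free_vars \<phi>"] by blast
  qed
  {
    case (Exists x \<phi>)
    then obtain p where p: "bij_betw p (pverts G) (pverts H)"
        "\<And>w. w \<in> pverts G \<Longrightarrow> sat G (\<alpha>(x := w)) \<phi> \<longleftrightarrow> sat H (\<beta>(x := p w)) \<phi>"
      using quantifier[of \<phi> x \<alpha> \<beta>] by auto
    then show ?case
      using bij_betw_ball_iff[of p "pverts G" "pverts H"
          "\<lambda>w. \<not> sat G (\<alpha>(x := w)) \<phi>" "\<lambda>w. \<not> sat H (\<beta>(x := w)) \<phi>"] by auto
  next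
    case (Forall x \<phi>)
    then obtain p where p: "bij_betw p (pverts G) (pverts H)"
        "\<And>w. w \<in> pverts G \<Longrightarrow> sat G (\<alpha>(x := w)) \<phi> \<longleftrightarrow> sat H (\<beta>(x := p w)) \<phi>"
      using quantifier[of \<phi> x \<alpha> \<beta>] by auto
    then show ?case
      using bij_betw_ball_iff[of p "pverts G" "pverts H"
          "\<lambda>w. sat G (\<alpha>(x := w)) \<phi>" "\<lambda>w. sat H (\<beta>(x := w)) \<phi>"] by auto
  next
    case (AtLeast i x \<phi>)
    then obtain p where p: "bij_betw p (pverts G) (pverts H)"
        "\<And>w. w \<in> pverts G \<Longrightarrow> sat G (\<alpha>(x := w)) \<phi> \<longleftrightarrow> sat H (\<beta>(x := p w)) \<phi>"
      using quantifier[of \<phi> x \<alpha> \<beta>] by auto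
    then show ?case
      using bij_betw_card_filter[of p "pverts G" "pverts H"
          "\<lambda>w. sat G (\<alpha>(x := w)) \<phi>" "\<lambda>w. sat H (\<beta>(x := w)) \<phi>"] by auto
  }
qed

lemma C_equiv_if_bijective_game:
  fixes G :: "'a pair_pre_digraph" and H :: "'b pair_pre_digraph"
    and I :: "nat set \<Rightarrow> (nat \<Rightarrow> 'a) \<Rightarrow> (nat \<Rightarrow> 'b) \<Rightarrow> bool"
  assumes "\<And>P \<alpha> \<beta> x y. I P \<alpha> \<beta> \<Longrightarrow> x \<in> P \<Longrightarrow> y \<in> P \<Longrightarrow> \<alpha> x = \<alpha> y \<longleftrightarrow> \<beta> x = \<beta> y"
    and "\<And>P \<alpha> \<beta> x y. I P \<alpha> \<beta> \<Longrightarrow> x \<in> P \<Longrightarrow> y \<in> P \<Longrightarrow>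
                 (\<alpha> x, \<alpha> y) \<in> parcs G \<longleftrightarrow> (\<beta> x, \<beta> y) \<in> parcs H"
    and "\<And>P Q \<alpha> \<beta>. I P \<alpha> \<beta> \<Longrightarrow> Q \<subseteq> P \<Longrightarrow> I Q \<alpha> \<beta>"
    and "\<And>P \<alpha> \<beta> x. I P \<alpha> \<beta> \<Longrightarrow> finite P \<Longrightarrow> card P < k \<Longrightarrow> x \<notin> P \<Longrightarrow>
                 \<exists>p. bij_betw p (pverts G) (pverts H) \<and>
                     (\<forall>w\<in>pverts G. I (insert x P) (\<alpha>(x := w)) (\<beta>(x := p w)))"
    and start: "\<And>\<alpha> \<beta>. I {} \<alpha> \<beta>"
  shows "C_equiv k G H"
proof -
  have "sat G \<alpha> \<phi> \<longleftrightarrow> sat H \<beta> \<phi>" if "C_sentence k \<phi>" for \<phi> \<alpha> \<beta>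
    using bijective_game_sat[of I G H k \<phi> \<alpha> \<beta>, OF assms(1-4)] start that
    by (simp add: C_sentence_def)
  then show ?thesis
    unfolding C_equiv_def models_def by blast
qed

section \<open>Renaming the vertices\<close>

definition rename_graph :: "('a \<Rightarrow> 'b) \<Rightarrow> 'a pair_pre_digraph \<Rightarrow> 'b pair_pre_digraph" where
  "rename_graph f G = \<lparr>pverts = f ` pverts G, parcs = map_prod f f ` parcs G\<rparr>"

lemma rename_graph_parcs_iff:
  assumes "inj_on f (pverts G)" "parcs G \<subseteq> pverts G \<times> pverts G" "u \<in> pverts G" "v \<in> pverts G"
  shows "(f u, f v) \<in> parcs (rename_graph f G) \<longleftrightarrow> (u, v) \<in> parcs G"
proof
  assume "(f u, f v) \<in> parcs (rename_graph f G)"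
  then obtain u' v' where *: "(u', v') \<in> parcs G" "f u = f u'" "f v = f v'"
    by (auto simp: rename_graph_def)
  then have "u' \<in> pverts G" "v' \<in> pverts G"
    using assms(2) by auto
  with * assms(1,3,4) have "u = u'" "v = v'"
    by (auto dest: inj_onD)
  with * show "(u, v) \<in> parcs G"
    by simp
qed (auto simp: rename_graph_def)

lemma pair_graph_rename_graph:
  assumes "inj_on f (pverts G)" "pair_graph G"
  shows "pair_graph (rename_graph f G)"
proof -
  from assms(2) have "finite (pverts G)" and sub: "parcs G \<subseteq> pverts G \<times> pverts G"
    and "sym (parcs G)" and irr: "irrefl (parcs G)"
    by (auto simp: pair_graph_iff)
  have "irrefl (parcs (rename_graph f G))"
    using irr sub assms(1) by (fastforce simp: rename_graph_def irrefl_def inj_on_def)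
  moreover have "sym (parcs (rename_graph f G))"
    using \<open>sym (parcs G)\<close> unfolding sym_def rename_graph_def by force
  ultimately show ?thesis
    using \<open>finite (pverts G)\<close> sub unfolding pair_graph_iff by (auto simp: rename_graph_def)
qed

text \<open>
  A renaming is itself a strategy for the game: answer every vertex with its new name.
\<close>

lemma C_equiv_rename_graph:
  assumes inj: "inj_on f (pverts G)" and G: "parcs G \<subseteq> pverts G \<times> pverts G"
  shows "C_equiv k G (rename_graph f G)"
proof -
  define I where "I P \<alpha> \<beta> \<longleftrightarrow> (\<forall>x\<in>P. \<alpha> x \<in> pverts G \<and> \<beta> x = f (\<alpha> x))"
    for P :: "nat set" and \<alpha> \<beta>
  show ?thesis
  proof (rule C_equiv_if_bijective_game[of I])
    fix P :: "nat set" and \<alpha> \<beta> and x y :: nat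
    assume I: "I P \<alpha> \<beta>" and "x \<in> P" "y \<in> P"
    then show "\<alpha> x = \<alpha> y \<longleftrightarrow> \<beta> x = \<beta> y"
      using inj_on_eq_iff[OF inj] by (simp add: I_def)
    show "(\<alpha> x, \<alpha> y) \<in> parcs G \<longleftrightarrow> (\<beta> x, \<beta> y) \<in> parcs (rename_graph f G)"
      using I \<open>x \<in> P\<close> \<open>y \<in> P\<close> rename_graph_parcs_iff[OF inj G] by (simp add: I_def)
  next
    fix P Q :: "nat set" and \<alpha> \<beta>
    assume "I P \<alpha> \<beta>" "Q \<subseteq> P"
    then show "I Q \<alpha> \<beta>"
      by (auto simp: I_def)
  next
    fix P :: "nat set" and \<alpha> \<beta> and x :: nat
    assume I: "I P \<alpha> \<beta>"
    have "bij_betw f (pverts G) (pverts (rename_graph f G))"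
      using inj by (simp add: bij_betw_def rename_graph_def)
    moreover have "\<forall>w\<in>pverts G. I (insert x P) (\<alpha>(x := w)) (\<beta>(x := f w))"
      using I by (simp add: I_def)
    ultimately show "\<exists>p. bij_betw p (pverts G) (pverts (rename_graph f G)) \<and>
        (\<forall>w\<in>pverts G. I (insert x P) (\<alpha>(x := w)) (\<beta>(x := p w)))"
      by blast
  next
    show "I {} \<alpha> \<beta>" for \<alpha> \<beta>
      by (simp add: I_def)
  qed
qed

lemma hom_count_rename_graph:
  assumes inj: "inj_on f (pverts G)" and G: "parcs G \<subseteq> pverts G \<times> pverts G"
  shows "hom_count (rename_graph f G) F = hom_count G F"
  unfolding hom_count_def
proof (rule bij_betw_same_card)
  let ?to = "\<lambda>h. \<lambda>v\<in>pverts G. h (f v)"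
  let ?from = "\<lambda>h. \<lambda>v\<in>f ` pverts G. h (inv_into (pverts G) f v)"
  show "bij_betw ?to (graph_homs (rename_graph f G) F) (graph_homs G F)"
  proof (rule bij_betw_byWitness[where f' = ?from])
  show "\<forall>h\<in>graph_homs (rename_graph f G) F. ?from (?to h) = h"
  proof (intro ballI ext)
    fix h x assume "h \<in> graph_homs (rename_graph f G) F"
    then have "h \<in> extensional (f ` pverts G)"
      by (simp add: graph_homs_def rename_graph_def PiE_def)
    from extensional_arb[OF this, of x] show "?from (?to h) x = h x"
      by (simp add: f_inv_into_f inv_into_into)
  qed
  show "\<forall>h\<in>graph_homs G F. ?to (?from h) = h"
  proof (intro ballI ext)
    fix h x assume "h \<in> graph_homs G F"
    then have "h \<in> extensional (pverts G)"
      by (simp add: graph_homs_def PiE_def)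
    from extensional_arb[OF this, of x] show "?to (?from h) x = h x"
      by (simp add: inv_into_f_f[OF inj])
  qed
  show "?to ` graph_homs (rename_graph f G) F \<subseteq> graph_homs G F"
  proof safe
    fix h assume h: "h \<in> graph_homs (rename_graph f G) F"
    then have "h (f v) \<in> pverts F" if "v \<in> pverts G" for v
      using that by (auto simp: graph_homs_def rename_graph_def)
    moreover have "(h (f u), h (f v)) \<in> parcs F" if "(u, v) \<in> parcs G" for u v
      using h that by (force simp: graph_homs_def rename_graph_def)
    ultimately show "?to h \<in> graph_homs G F"
      using G by (auto simp: graph_homs_def subset_iff)
  qed
  show "?from ` graph_homs G F \<subseteq> graph_homs (rename_graph f G) F"
  proof safe
    fix h assume h: "h \<in> graph_homs G F"
    have "?from h \<in> f ` pverts G \<rightarrow>\<^sub>E pverts F"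
      using h inj by (auto simp: graph_homs_def PiE_def Pi_def)
    moreover have arcs: "(?from h (f u), ?from h (f v)) \<in> parcs F" if "(u, v) \<in> parcs G" for u v
      using h inj that subsetD[OF G that] by (auto simp: graph_homs_def)
    then have "(?from h x, ?from h y) \<in> parcs F" if "(x, y) \<in> parcs (rename_graph f G)" for x y
    proof -
      from that obtain u v where "(u, v) \<in> parcs G" "x = f u" "y = f v"
        by (auto simp: rename_graph_def)
      with arcs show ?thesis
        by blast
    qed
    ultimately show "?from h \<in> graph_homs (rename_graph f G) F"
      unfolding graph_homs_def by (simp add: rename_graph_def del: restrict_apply)
  qed
qed
qed

section \<open>Complete graphs\<close>

definition complete_graph :: "nat \<Rightarrow> nat pair_pre_digraph" where
  "complete_graph n = \<lparr>pverts = {..<n}, parcs = {(u, v). u < n \<and> v < n \<and> u \<noteq> v}\<rparr>"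

lemma complete_graph_in_graphs: "complete_graph n \<in> graphs"
  unfolding graphs_def mem_Collect_eq pair_graph_iff
  by (auto simp: complete_graph_def sym_def irrefl_def)

lemma complete_graphs_not_C_equiv:
  assumes "m < n"
  shows "\<not> C_equiv 1 (complete_graph m) (complete_graph n)"
proof -
  let ?\<phi> = "AtLeast n 0 (Eq 0 0)"
  have "C_sentence 1 ?\<phi>" and "models (complete_graph n) ?\<phi>" and "\<not> models (complete_graph m) ?\<phi>"
    using assms by (simp_all add: C_sentence_def models_def complete_graph_def)
  then show ?thesis
    unfolding C_equiv_def by blast
qed

text \<open>
  In the image of a triangle, two vertices have the third one as a common neighbour.  If this
  makes their neighbourhoods equal, each of them is its own neighbour.
\<close>

lemma no_hom_from_complete_graph:
  assumes F: "pair_graph F" and "n \<ge> 3"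
    and twins: "\<And>a b c. (a, c) \<in> parcs F \<Longrightarrow> (b, c) \<in> parcs F \<Longrightarrow>
                  {z. (a, z) \<in> parcs F} = {z. (b, z) \<in> parcs F}"
  shows "hom_count (complete_graph n) F = 0"
proof -
  have "h \<notin> graph_homs (complete_graph n) F" for h
  proof
    assume "h \<in> graph_homs (complete_graph n) F"
    then have hom: "(h u, h v) \<in> parcs F" if "u < n" "v < n" "u \<noteq> v" for u v
      using that by (simp add: graph_homs_def complete_graph_def)
    have "(h 0, h 1) \<in> parcs F" "(h 0, h 2) \<in> parcs F" "(h 1, h 2) \<in> parcs F"
      using hom \<open>n \<ge> 3\<close> by auto
    with twins[of "h 0" "h 2" "h 1"] have "(h 1, h 1) \<in> parcs F"
      by blast
    with F show False
      by (auto simp: pair_graph_iff irrefl_def)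
  qed
  then show ?thesis
    unfolding hom_count_def by (metis card.empty ex_in_conv)
qed

section \<open>Twisted graphs over the hypercube\<close>

text \<open>
  The vertices of the cube are the subsets of \<open>{..<d}\<close>.  The pair \<open>(i, w)\<close> stands for the edge
  between \<open>w\<close> and \<open>insert i w\<close>; so the edge at \<open>v\<close> in direction \<open>i\<close> is \<open>(i, v - {i})\<close>.
\<close>

definition cube_edges :: "nat \<Rightarrow> (nat \<times> nat set) set" where
  "cube_edges d = (SIGMA i : {..<d}. Pow ({..<d} - {i}))"

text \<open>
  \<open>Link i w q\<close> is one of the two vertices for the edge \<open>(i, w)\<close>.  In \<open>Core v s\<close>, the set \<open>s\<close> contains
  the directions in which the cube vertex \<open>v\<close> chooses the link with \<open>q = True\<close>.
\<close>

datatype cfi_vertex = Link nat "nat set" bool | Core "nat set" "nat set"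

fun link_to_core :: "cfi_vertex \<Rightarrow> cfi_vertex \<Rightarrow> bool" where
  "link_to_core (Link i w q) (Core v s) \<longleftrightarrow> w = v - {i} \<and> q = (i \<in> s)"
| "link_to_core _ _ \<longleftrightarrow> False"

definition core_patterns :: "nat \<Rightarrow> bool \<Rightarrow> nat set set" where
  "core_patterns d p = {s. s \<subseteq> {..<d} \<and> odd (card s) = p}"

definition links :: "nat \<Rightarrow> cfi_vertex set" where
  "links d = {Link i w q |i w q. (i, w) \<in> cube_edges d}"

text \<open>
  If \<open>p\<close> holds, the parity is changed at the cube vertex \<open>{}\<close>.
\<close>

definition cores :: "nat \<Rightarrow> bool \<Rightarrow> cfi_vertex set" where
  "cores d p = {Core v s |v s. v \<subseteq> {..<d} \<and> s \<in> core_patterns d (p \<and> v = {})}"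

definition cfi_graph :: "nat \<Rightarrow> bool \<Rightarrow> cfi_vertex pair_pre_digraph" where
  "cfi_graph d p = \<lparr>pverts = links d \<union> cores d p,
     parcs = {(x, y). x \<in> links d \<union> cores d p \<and> y \<in> links d \<union> cores d p \<and>
                      (link_to_core x y \<or> link_to_core y x)}\<rparr>"

lemma finite_cube_edges: "finite (cube_edges d)"
  by (simp add: cube_edges_def)

lemma finite_core_patterns: "finite (core_patterns d p)"
  by (rule finite_subset[of _ "Pow {..<d}"]) (auto simp: core_patterns_def)

lemma finite_links: "finite (links d)"
proof -
  have "links d = (\<lambda>((i, w), q). Link i w q) ` (cube_edges d \<times> UNIV)"
    by (force simp: links_def)
  then show ?thesis
    by (simp add: finite_cube_edges)
qed

lemma cores_eq_image:
  "cores d p = (\<lambda>(v, s). Core v s) ` (SIGMA v : Pow {..<d}. core_patterns d (p \<and> v = {}))"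
  by (force simp: cores_def)

lemma finite_cores: "finite (cores d p)"
  by (simp add: cores_eq_image finite_core_patterns)

lemma pair_graph_cfi_graph: "pair_graph (cfi_graph d p)"
proof -
  have "\<not> link_to_core x x" for x
    by (cases x) auto
  then show ?thesis
    by (auto simp: pair_graph_iff cfi_graph_def finite_links finite_cores sym_def irrefl_def)
qed

section \<open>Moving the twist\<close>

lemma odd_card_xor:
  assumes "finite s" "finite t"
  shows "odd (card {i. (i \<in> s) \<noteq> (i \<in> t)}) \<longleftrightarrow> (odd (card s) \<noteq> odd (card t))"
proof -
  have split: "{i. (i \<in> s) \<noteq> (i \<in> t)} = (s - t) \<union> (t - s)"
    by blast
  have "card (s - t) + card (s \<inter> t) = card s" "card (t - s) + card (s \<inter> t) = card t"
    using assms card_Diff_subset_Int[of s t] card_Diff_subset_Int[of t s]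
      card_mono[of s "s \<inter> t"] card_mono[of t "s \<inter> t"]
    by (auto simp: Int_commute)
  moreover have "card {i. (i \<in> s) \<noteq> (i \<in> t)} = card (s - t) + card (t - s)"
    unfolding split using assms by (intro card_Un_disjoint) auto
  ultimately have "card {i. (i \<in> s) \<noteq> (i \<in> t)} + 2 * card (s \<inter> t) = card s + card t"
    by simp
  moreover have "odd n \<longleftrightarrow> odd a \<noteq> odd b" if "n + 2 * m = a + b" for n m a b :: nat
    using that by presburger
  ultimately show ?thesis
    by blast
qed

definition incident :: "(nat \<times> nat set) set \<Rightarrow> nat set \<Rightarrow> nat set" where
  "incident c v = {i. (i, v - {i}) \<in> c}"

text \<open>
  Exchanging the two links of each edge in \<open>c\<close> respects adjacency, but it changes the parity at
  every cube vertex with an odd number of incident edges in \<open>c\<close>.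
\<close>

fun flip :: "(nat \<times> nat set) set \<Rightarrow> cfi_vertex \<Rightarrow> cfi_vertex" where
  "flip c (Link i w q) = Link i w (q \<noteq> ((i, w) \<in> c))"
| "flip c (Core v s) = Core v {i. (i \<in> s) \<noteq> (i \<in> incident c v)}"

lemma flip_flip [simp]: "flip c (flip c x) = x"
  by (cases x) auto

lemma flip_eq_iff [simp]: "flip c x = flip c y \<longleftrightarrow> x = y"
  by (metis flip_flip)

lemma link_to_core_flip [simp]: "link_to_core (flip c x) (flip c y) \<longleftrightarrow> link_to_core x y"
  by (cases x; cases y) (auto simp: incident_def)

text \<open>
  \<open>flip c\<close> moves the twist from \<open>{}\<close> to \<open>u\<close>: it is an isomorphism between the untwisted and the
  twisted graph, except that the core vertices at \<open>u\<close> get the wrong parity.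
\<close>

definition twist_at :: "nat \<Rightarrow> (nat \<times> nat set) set \<Rightarrow> nat set \<Rightarrow> bool" where
  "twist_at d c u \<longleftrightarrow> c \<subseteq> cube_edges d \<and> u \<subseteq> {..<d} \<and>
     (\<forall>v\<subseteq>{..<d}. odd (card (incident c v)) \<longleftrightarrow> (v = {}) \<noteq> (v = u))"

lemma incident_subset: "c \<subseteq> cube_edges d \<Longrightarrow> incident c v \<subseteq> {..<d}"
  by (auto simp: incident_def cube_edges_def)

lemma flip_mem_cfi_graph:
  assumes c: "twist_at d c u" and x: "x \<in> pverts (cfi_graph d p)" and "\<And>s. x \<noteq> Core u s"
  shows "flip c x \<in> pverts (cfi_graph d (\<not> p))"
proof (cases x)
  case (Link i w q)
  with x show ?thesis
    by (auto simp: cfi_graph_def links_def cores_def)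
next
  case (Core v s)
  with x have v: "v \<subseteq> {..<d}" and s: "s \<subseteq> {..<d}" "odd (card s) = (p \<and> v = {})"
    by (auto simp: cfi_graph_def links_def cores_def core_patterns_def)
  have inc: "incident c v \<subseteq> {..<d}"
    using c incident_subset by (auto simp: twist_at_def)
  have "odd (card {i. (i \<in> s) \<noteq> (i \<in> incident c v)}) \<longleftrightarrow> odd (card s) \<noteq> odd (card (incident c v))"
    using s inc by (intro odd_card_xor) (auto intro: finite_subset)
  moreover have "odd (card (incident c v)) \<longleftrightarrow> v = {}"
    using c v assms(3) Core by (auto simp: twist_at_def)
  ultimately have "odd (card {i. (i \<in> s) \<noteq> (i \<in> incident c v)}) = (\<not> p \<and> v = {})"
    using s by auto
  moreover have "{i. (i \<in> s) \<noteq> (i \<in> incident c v)} \<subseteq> {..<d}"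
    using s inc by blast
  ultimately show ?thesis
    using Core v by (auto simp: cfi_graph_def cores_def core_patterns_def)
qed

lemma twist_at_step:
  assumes c: "twist_at d c u" and i: "i < d"
  defines "c' \<equiv> {e. (e \<in> c) \<noteq> (e = (i, u - {i}))}" and "u' \<equiv> {j. (j \<in> u) \<noteq> (j = i)}"
  shows "twist_at d c' u'"
proof -
  have u: "u \<subseteq> {..<d}" and c_sub: "c \<subseteq> cube_edges d"
    and par: "\<And>v. v \<subseteq> {..<d} \<Longrightarrow> odd (card (incident c v)) \<longleftrightarrow> (v = {}) \<noteq> (v = u)"
    using c by (auto simp: twist_at_def)
  have "u \<noteq> u'"
    by (auto simp: u'_def)
  have c'_sub: "c' \<subseteq> cube_edges d"
    using c_sub u i by (auto simp: c'_def cube_edges_def)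
  have u'_sub: "u' \<subseteq> {..<d}"
    using u i by (auto simp: u'_def)
  have "odd (card (incident c' v)) \<longleftrightarrow> (v = {}) \<noteq> (v = u')" if v: "v \<subseteq> {..<d}" for v
  proof -
    have end_iff: "v - {i} = u - {i} \<longleftrightarrow> v = u \<or> v = u'"
      by (auto simp: u'_def)
    have "incident c' v = {j. (j \<in> incident c v) \<noteq> (j \<in> (if v - {i} = u - {i} then {i} else {}))}"
      by (auto simp: incident_def c'_def)
    moreover have "finite (incident c v)"
      using incident_subset[OF c_sub] finite_subset by blast
    ultimately have "odd (card (incident c' v)) \<longleftrightarrow>
        odd (card (incident c v)) \<noteq> (v = u \<or> v = u')"
      using odd_card_xor[of "incident c v" "if v - {i} = u - {i} then {i} else {}"] end_iff
      by simp
    with par[OF v] \<open>u \<noteq> u'\<close> show ?thesis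
      by auto
  qed
  with c'_sub u'_sub show ?thesis
    by (auto simp: twist_at_def)
qed

text \<open>
  A pebble blocks the direction \<open>i\<close> at \<open>u\<close> if it lies on a link of the edge in direction \<open>i\<close> or on a
  core vertex at the other end of this edge.  Different directions are blocked by different pebbles.
\<close>

lemma exists_free_direction:
  assumes "finite X" "card X < d"
  shows "\<exists>i<d. (\<forall>q. Link i (u - {i}) q \<notin> X) \<and> (\<forall>s. Core {j. (j \<in> u) \<noteq> (j = i)} s \<notin> X)"
proof (rule ccontr)
  assume "\<not> ?thesis"
  then have "\<forall>i\<in>{..<d}. \<exists>x\<in>X. (\<exists>q. x = Link i (u - {i}) q) \<or> (\<exists>s. x = Core {j. (j \<in> u) \<noteq> (j = i)} s)"
    by blast
  from bchoice[OF this[unfolded Bex_def]] obtain f where f: "\<And>i. i < d \<Longrightarrow> f i \<in> X"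
    "\<And>i. i < d \<Longrightarrow> (\<exists>q. f i = Link i (u - {i}) q) \<or> (\<exists>s. f i = Core {j. (j \<in> u) \<noteq> (j = i)} s)"
    by auto
  have xor_inj: "i = i'" if "{j. (j \<in> u) \<noteq> (j = i)} = {j. (j \<in> u) \<noteq> (j = i')}" for i i'
    using that by blast
  have "inj_on f {..<d}"
  proof (rule inj_onI)
    fix i i' assume "i \<in> {..<d}" "i' \<in> {..<d}" "f i = f i'"
    then show "i = i'"
      using f(2)[of i] f(2)[of i'] xor_inj[of i i'] by auto
  qed
  then have "d \<le> card X"
    using card_inj_on_le[of f "{..<d}" X] f(1) assms(1) by auto
  with assms(2) show False
    by simp
qed

text \<open>
  Duplicator maintains some \<open>c\<close> that moves the twist to a cube vertex \<open>u\<close> such that no core vertex at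
  \<open>u\<close> is pebbled, and answers by \<open>flip c\<close>.  Only for the core vertices at \<open>u\<close> does she need another
  answer.  There she uses \<open>flip c'\<close>, where \<open>c'\<close> moves the twist on to the end of a free edge at \<open>u\<close>;
  as this edge and its ends carry no pebbles, \<open>c'\<close> agrees with \<open>c\<close> on the pebbles.
\<close>

lemma cfi_graphs_C_equiv:
  assumes "k \<le> d"
  shows "C_equiv k (cfi_graph d False) (cfi_graph d True)"
proof -
  let ?V = "\<lambda>p. pverts (cfi_graph d p)"
  define I where "I P \<alpha> \<beta> \<longleftrightarrow> (\<exists>c u. twist_at d c u \<and>
      (\<forall>x\<in>P. \<alpha> x \<in> ?V False \<and> \<beta> x = flip c (\<alpha> x) \<and> (\<forall>s. \<alpha> x \<noteq> Core u s)))"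
    for P :: "nat set" and \<alpha> \<beta>
  show ?thesis
  proof (rule C_equiv_if_bijective_game[of I])
    fix P :: "nat set" and \<alpha> \<beta> and x y :: nat
    assume "I P \<alpha> \<beta>" and xy: "x \<in> P" "y \<in> P"
    then obtain c u where c: "twist_at d c u"
      and \<alpha>: "\<And>x. x \<in> P \<Longrightarrow> \<alpha> x \<in> ?V False \<and> \<beta> x = flip c (\<alpha> x) \<and> (\<forall>s. \<alpha> x \<noteq> Core u s)"
      by (auto simp: I_def)
    show "\<alpha> x = \<alpha> y \<longleftrightarrow> \<beta> x = \<beta> y"
      using \<alpha> xy by simp
    have "\<beta> x \<in> ?V True" "\<beta> y \<in> ?V True"
      using flip_mem_cfi_graph[OF c, of _ False] \<alpha> xy by auto
    then show "(\<alpha> x, \<alpha> y) \<in> parcs (cfi_graph d False) \<longleftrightarrow> (\<beta> x, \<beta> y) \<in> parcs (cfi_graph d True)"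
      using \<alpha>[OF xy(1)] \<alpha>[OF xy(2)] by (simp add: cfi_graph_def)
  next
    fix P Q :: "nat set" and \<alpha> \<beta>
    assume "I P \<alpha> \<beta>" "Q \<subseteq> P"
    then show "I Q \<alpha> \<beta>"
      unfolding I_def by blast
  next
    fix P :: "nat set" and \<alpha> \<beta> and x :: nat
    assume "I P \<alpha> \<beta>" and P: "finite P" "card P < k"
    then obtain c u where c: "twist_at d c u"
      and \<alpha>: "\<And>x. x \<in> P \<Longrightarrow> \<alpha> x \<in> ?V False \<and> \<beta> x = flip c (\<alpha> x) \<and> (\<forall>s. \<alpha> x \<noteq> Core u s)"
      by (auto simp: I_def)
    have "card (\<alpha> ` P) < d"
      using card_image_le[OF P(1), of \<alpha>] P(2) assms by simp
    then obtain i where i: "i < d" "\<And>q. Link i (u - {i}) q \<notin> \<alpha> ` P"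
        "\<And>s. Core {j. (j \<in> u) \<noteq> (j = i)} s \<notin> \<alpha> ` P"
      using exists_free_direction[of "\<alpha> ` P" d u] P(1) by auto
    define c' where "c' = {e. (e \<in> c) \<noteq> (e = (i, u - {i}))}"
    define u' where "u' = {j. (j \<in> u) \<noteq> (j = i)}"
    have c': "twist_at d c' u'"
      unfolding c'_def u'_def using twist_at_step[OF c i(1)] .
    have "u' \<noteq> u"
      by (auto simp: u'_def)
    have same: "flip c' (\<alpha> y) = flip c (\<alpha> y) \<and> (\<forall>s. \<alpha> y \<noteq> Core u' s)" if "y \<in> P" for y
    proof (cases "\<alpha> y")
      case (Link j w q)
      with that i(2) have "(j, w) \<noteq> (i, u - {i})"
        by (metis Pair_inject image_eqI)
      with Link show ?thesis
        by (auto simp: c'_def)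
    next
      case (Core v s)
      with that i(3) have "v \<noteq> u'"
        unfolding u'_def by (metis image_eqI)
      moreover have "v \<noteq> u"
        using \<alpha>[OF that] Core by auto
      ultimately have "v - {i} \<noteq> u - {i}"
        unfolding u'_def by auto
      then have "incident c' v = incident c v"
        by (auto simp: incident_def c'_def)
      with Core \<open>v \<noteq> u'\<close> show ?thesis
        by auto
    qed
    \<comment> \<open>Both flips keep the cube vertex of a core vertex, so \<open>p\<close> is an involution.\<close>
    define p where "p w = (if \<exists>s. w = Core u s then flip c' w else flip c w)" for w
    have core_iff: "(\<exists>s. flip e w = Core v s) \<longleftrightarrow> (\<exists>s. w = Core v s)" for e w v
      by (cases w) auto
    have p_mem: "p w \<in> ?V (\<not> b)" if "w \<in> ?V b" for w b
      using that flip_mem_cfi_graph[OF c that] flip_mem_cfi_graph[OF c' that] \<open>u' \<noteq> u\<close>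
      unfolding p_def by auto
    have p_p: "p (p w) = w" for w
      using core_iff[of _ w u] by (auto simp: p_def)
    have "bij_betw p (?V False) (?V True)"
      using p_mem[of _ False] p_mem[of _ True] p_p
      by (intro bij_betw_byWitness[where f' = p]) auto
    moreover have "I (insert x P) (\<alpha>(x := w)) (\<beta>(x := p w))" if w: "w \<in> ?V False" for w
    proof (cases "\<exists>s. w = Core u s")
      case True
      then have "twist_at d c' u' \<and> (\<forall>y\<in>insert x P. (\<alpha>(x := w)) y \<in> ?V False \<and>
          (\<beta>(x := p w)) y = flip c' ((\<alpha>(x := w)) y) \<and> (\<forall>s. (\<alpha>(x := w)) y \<noteq> Core u' s))"
        using c' w \<alpha> same \<open>u' \<noteq> u\<close> by (auto simp: p_def)
      then show ?thesis
        unfolding I_def by blast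
    next
      case False
      then have "twist_at d c u \<and> (\<forall>y\<in>insert x P. (\<alpha>(x := w)) y \<in> ?V False \<and>
          (\<beta>(x := p w)) y = flip c ((\<alpha>(x := w)) y) \<and> (\<forall>s. (\<alpha>(x := w)) y \<noteq> Core u s))"
        using c w \<alpha> by (auto simp: p_def)
      then show ?thesis
        unfolding I_def by blast
    qed
    ultimately show "\<exists>p. bij_betw p (?V False) (?V True) \<and>
        (\<forall>w\<in>?V False. I (insert x P) (\<alpha>(x := w)) (\<beta>(x := p w)))"
      by blast
  next
    have "twist_at d {} {}"
      by (simp add: twist_at_def incident_def)
    then show "I {} \<alpha> \<beta>" for \<alpha> \<beta>
      unfolding I_def by blast
  qed
qed

section \<open>Reflection positivity\<close>

text \<open>
  An abstract form of the local tensors.  A tensor \<open>\<Phi> p\<close> has \<open>d\<close> legs with values in \<open>X\<close>, and \<open>swap\<close>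
  applied to one leg changes its parity \<open>p\<close>.
\<close>

locale twisted_tensor =
  fixes d :: nat and X :: "'x set" and swap :: "'x \<Rightarrow> 'x"
    and \<Phi> :: "bool \<Rightarrow> (nat \<Rightarrow> 'x) \<Rightarrow> int"
  assumes finite_X: "finite X"
    and swap_mem: "x \<in> X \<Longrightarrow> swap x \<in> X"
    and swap_swap: "swap (swap x) = x"
    and \<Phi>_cong: "(\<And>i. i < d \<Longrightarrow> g i = g' i) \<Longrightarrow> \<Phi> p g = \<Phi> p g'"
    and \<Phi>_swap: "i < d \<Longrightarrow> \<Phi> p (g(i := swap (g i))) = \<Phi> (\<not> p) g"
begin

text \<open>
  The tensors at the subcube with vertex set \<open>Pow {..<j}\<close> are contracted along the edges of the
  subcube.  The legs in the directions from \<open>j\<close> on remain open: \<open>z i v\<close> is the value of the leg at \<open>v\<close>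
  in direction \<open>i\<close>.  If \<open>p\<close> holds, the tensor at \<open>{}\<close> is twisted.
\<close>

definition partial_sum :: "nat \<Rightarrow> bool \<Rightarrow> (nat \<Rightarrow> nat set \<Rightarrow> 'x) \<Rightarrow> int" where
  "partial_sum j p z = (\<Sum>y \<in> cube_edges j \<rightarrow>\<^sub>E X. \<Prod>v \<in> Pow {..<j}.
      \<Phi> (p \<and> v = {}) (\<lambda>i. if i < j then y (i, v - {i}) else z i v))"

definition upper_half :: "nat \<Rightarrow> (nat \<Rightarrow> nat set \<Rightarrow> 'x) \<Rightarrow> nat \<Rightarrow> nat set \<Rightarrow> 'x" where
  "upper_half j z = (\<lambda>i v. z i (insert j v))"

lemma partial_sum_cong:
  assumes "\<And>i v. j \<le> i \<Longrightarrow> i < d \<Longrightarrow> v \<subseteq> {..<j} \<Longrightarrow> z i v = z' i v"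
  shows "partial_sum j p z = partial_sum j p z'"
  unfolding partial_sum_def
  by (intro sum.cong prod.cong refl \<Phi>_cong) (use assms in auto)

lemma partial_sum_0: "partial_sum 0 p z = \<Phi> p (\<lambda>i. z i {})"
  by (simp add: partial_sum_def cube_edges_def)

text \<open>
  The subcube of dimension \<open>j + 1\<close> consists of two copies of the one of dimension \<open>j\<close>, glued along the
  legs in direction \<open>j\<close>, whose common value is \<open>t\<close>.  The twist lies in the copy that contains \<open>{}\<close>.
\<close>

lemma partial_sum_Suc:
  "partial_sum (Suc j) p z = (\<Sum>t \<in> Pow {..<j} \<rightarrow>\<^sub>E X.
     partial_sum j p (z(j := t)) * partial_sum j False ((upper_half j z)(j := t)))"
proof -
  let ?E = "cube_edges j" and ?E' = "cube_edges (Suc j)"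
  let ?T = "(Pow {..<j} \<rightarrow>\<^sub>E X) \<times> (?E \<rightarrow>\<^sub>E X) \<times> (?E \<rightarrow>\<^sub>E X)"
  define A where "A p z y = (\<Prod>v \<in> Pow {..<j}.
      \<Phi> (p \<and> v = {}) (\<lambda>i. if i < j then y (i, v - {i}) else z i v))" for p z y
  \<comment> \<open>An assignment to the edges of the large subcube amounts to one for the glued edges and one
    for the edges of each copy.\<close>
  define join where "join = (\<lambda>(t, y1, y2). \<lambda>(i, w)\<in>?E'.
      if i = j then t w else if j \<in> w then y2 (i, w - {j}) else (y1 (i, w) :: 'x))"
  define cut where "cut y = (\<lambda>w\<in>Pow {..<j}. y (j, w), \<lambda>e\<in>?E. y e,
      \<lambda>(i, w)\<in>?E. (y (i, insert j w) :: 'x))" for y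
  have edge: "(i, w) \<in> ?E \<Longrightarrow> i < j \<and> j \<notin> w \<and> (i, w) \<in> ?E' \<and> (i, insert j w) \<in> ?E'" for i w
    by (auto simp: cube_edges_def)
  have edge': "(i, w) \<in> ?E' \<Longrightarrow> i = j \<and> w \<in> Pow {..<j} \<or>
      i \<noteq> j \<and> j \<in> w \<and> (i, w - {j}) \<in> ?E \<or> i \<noteq> j \<and> j \<notin> w \<and> (i, w) \<in> ?E" for i w
    by (auto simp: cube_edges_def less_Suc_eq)
  have edge_j: "w \<subseteq> {..<j} \<Longrightarrow> (j, w) \<in> ?E'" for w
    by (auto simp: cube_edges_def)
  have "partial_sum (Suc j) p z = (\<Sum>(t, y1, y2) \<in> ?T.
      A p (z(j := t)) y1 * A False ((upper_half j z)(j := t)) y2)"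
    unfolding partial_sum_def
  proof (rule sum.reindex_bij_witness[where i = join and j = cut])
    fix y assume y: "y \<in> ?E' \<rightarrow>\<^sub>E X"
    then have y_mem: "e \<in> ?E' \<Longrightarrow> y e \<in> X" for e
      by blast
    show "cut y \<in> ?T"
      using y_mem edge edge_j by (auto simp: cut_def)
    show "join (cut y) = y"
    proof
      fix e :: "nat \<times> nat set"
      obtain i w where e: "e = (i, w)" by force
      show "join (cut y) e = y e"
      proof (cases "e \<in> ?E'")
        case True
        with edge'[of i w] e show ?thesis
          by (auto simp: join_def cut_def insert_absorb)
      next
        case False
        with y e show ?thesis
          by (auto simp: join_def cut_def)
      qed
    qed
    have lower: "(\<lambda>i. if i < Suc j then y (i, v - {i}) else z i v) =
        (\<lambda>i. if i < j then (\<lambda>e\<in>?E. y e) (i, v - {i}) else (z(j := \<lambda>w\<in>Pow {..<j}. y (j, w))) i v)"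
      if "v \<subseteq> {..<j}" for v
    proof
      fix i
      have "i < j \<Longrightarrow> (i, v - {i}) \<in> ?E" "v - {j} = v"
        using that by (auto simp: cube_edges_def)
      with that show "(if i < Suc j then y (i, v - {i}) else z i v) =
        (if i < j then (\<lambda>e\<in>?E. y e) (i, v - {i}) else (z(j := \<lambda>w\<in>Pow {..<j}. y (j, w))) i v)"
        by (cases i j rule: linorder_cases) auto
    qed
    have upper: "(\<lambda>i. if i < Suc j then y (i, insert j v - {i}) else z i (insert j v)) =
        (\<lambda>i. if i < j then (\<lambda>(i, w)\<in>?E. y (i, insert j w)) (i, v - {i})
              else ((upper_half j z)(j := \<lambda>w\<in>Pow {..<j}. y (j, w))) i v)"
      if "v \<subseteq> {..<j}" for v
    proof
      fix i
      have "i < j \<Longrightarrow> (i, v - {i}) \<in> ?E" "insert j v - {j} = v"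
        "i \<noteq> j \<Longrightarrow> insert j v - {i} = insert j (v - {i})"
        using that by (auto simp: cube_edges_def)
      with that show "(if i < Suc j then y (i, insert j v - {i}) else z i (insert j v)) =
        (if i < j then (\<lambda>(i, w)\<in>?E. y (i, insert j w)) (i, v - {i})
              else ((upper_half j z)(j := \<lambda>w\<in>Pow {..<j}. y (j, w))) i v)"
        by (cases i j rule: linorder_cases) (auto simp: upper_half_def)
    qed
    let ?f = "\<lambda>v. \<Phi> (p \<and> v = {}) (\<lambda>i. if i < Suc j then y (i, v - {i}) else z i v)"
    have "Pow {..<Suc j} = Pow {..<j} \<union> insert j ` Pow {..<j}"
      by (simp add: lessThan_Suc Pow_insert)
    moreover have "Pow {..<j} \<inter> insert j ` Pow {..<j} = {}"
      by auto
    moreover have "inj_on (insert j) (Pow {..<j})"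
      by (auto simp: inj_on_def)
    ultimately have "prod ?f (Pow {..<Suc j}) =
        prod ?f (Pow {..<j}) * prod (?f \<circ> insert j) (Pow {..<j})"
      by (simp add: prod.union_disjoint prod.reindex)
    also have "prod ?f (Pow {..<j}) = A p (z(j := \<lambda>w\<in>Pow {..<j}. y (j, w))) (\<lambda>e\<in>?E. y e)"
      unfolding A_def by (intro prod.cong refl) (simp only: lower Pow_iff)
    also have "prod (?f \<circ> insert j) (Pow {..<j}) =
        A False ((upper_half j z)(j := \<lambda>w\<in>Pow {..<j}. y (j, w))) (\<lambda>(i, w)\<in>?E. y (i, insert j w))"
      unfolding A_def by (intro prod.cong refl) (simp only: upper Pow_iff o_apply insert_not_empty simp_thms)
    finally show "(case cut y of (t, y1, y2) \<Rightarrow>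
        A p (z(j := t)) y1 * A False ((upper_half j z)(j := t)) y2) = prod ?f (Pow {..<Suc j})"
      by (simp only: cut_def prod.case)
  next
    fix a assume "a \<in> ?T"
    then obtain t y1 y2 where a: "a = (t, y1, y2)"
      and t: "t \<in> Pow {..<j} \<rightarrow>\<^sub>E X" and y1: "y1 \<in> ?E \<rightarrow>\<^sub>E X" and y2: "y2 \<in> ?E \<rightarrow>\<^sub>E X"
      by blast
    show "join a \<in> ?E' \<rightarrow>\<^sub>E X"
    proof (rule PiE_I)
      fix e assume e: "e \<in> ?E'"
      obtain i w where iw: "e = (i, w)" by force
      show "join a e \<in> X"
        using e iw edge'[of i w] t y1 y2 by (auto simp: a join_def)
    qed (auto simp: a join_def)
    have "(\<lambda>w\<in>Pow {..<j}. join a (j, w)) = t"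
      using t edge_j by (auto simp: fun_eq_iff a join_def PiE_def extensional_def)
    moreover have "(\<lambda>e\<in>?E. join a e) = y1"
      using y1 edge by (fastforce simp: fun_eq_iff a join_def PiE_def extensional_def)
    moreover have "(\<lambda>(i, w)\<in>?E. join a (i, insert j w)) = y2"
      using y2 edge by (fastforce simp: fun_eq_iff a join_def PiE_def extensional_def)
    ultimately show "cut (join a) = a"
      by (simp only: cut_def a)
  qed
  also have "\<dots> = (\<Sum>t \<in> Pow {..<j} \<rightarrow>\<^sub>E X.
      (\<Sum>y1 \<in> ?E \<rightarrow>\<^sub>E X. A p (z(j := t)) y1) * (\<Sum>y2 \<in> ?E \<rightarrow>\<^sub>E X. A False ((upper_half j z)(j := t)) y2))"
    by (simp only: sum.cartesian_product[symmetric] sum_product)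
  also have "\<dots> = (\<Sum>t \<in> Pow {..<j} \<rightarrow>\<^sub>E X.
     partial_sum j p (z(j := t)) * partial_sum j False ((upper_half j z)(j := t)))"
    by (simp only: partial_sum_def A_def)
  finally show ?thesis .
qed

definition swap_leg :: "nat \<Rightarrow> nat set \<Rightarrow> (nat \<Rightarrow> nat set \<Rightarrow> 'x) \<Rightarrow> nat \<Rightarrow> nat set \<Rightarrow> 'x" where
  "swap_leg i v z = z(i := (z i)(v := swap (z i v)))"

lemma swap_leg_update: "swap_leg j {} (z(j := t)) = z(j := t({} := swap (t {})))"
  by (simp add: swap_leg_def)

lemma sum_swap_root:
  "(\<Sum>t \<in> Pow {..<j} \<rightarrow>\<^sub>E X. f t) = (\<Sum>t \<in> Pow {..<j} \<rightarrow>\<^sub>E X. (f (t({} := swap (t {}))) :: int))"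
  by (rule sum.reindex_bij_witness[where i = "\<lambda>t. t({} := swap (t {}))" and j = "\<lambda>t. t({} := swap (t {}))"])
     (auto simp: swap_swap swap_mem PiE_def Pi_def extensional_def)

text \<open>
  The place of the twist does not matter: swapping any open leg twists the whole sum.  In the
  inductive step, a leg of the upper copy twists the upper factor.  Swapping the summation
  variable on the glued leg at \<open>{}\<close> twists both factors at once, and so moves the twist to the lower
  factor.
\<close>

lemma partial_sum_swap_leg:
  "j \<le> i \<Longrightarrow> i < d \<Longrightarrow> v \<subseteq> {..<j} \<Longrightarrow> partial_sum j p (swap_leg i v z) = partial_sum j (\<not> p) z"
proof (induction j arbitrary: p z i v)
  case 0
  then have "(\<lambda>i'. swap_leg i v z i' {}) = (\<lambda>i'. z i' {})(i := swap (z i {}))"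
    by (auto simp: swap_leg_def)
  then show ?case
    using \<Phi>_swap[OF \<open>i < d\<close>, of p "\<lambda>i'. z i' {}"] by (simp add: partial_sum_0)
next
  case (Suc j)
  have "i \<noteq> j" "j \<le> i" "j < d" using Suc.prems by auto
  let ?T = "Pow {..<j} \<rightarrow>\<^sub>E X"
  show ?case
  proof (cases "j \<in> v")
    case False
    have v: "v \<subseteq> {..<j}"
      using Suc.prems(3) False by (auto simp: less_Suc_eq)
    have low: "(swap_leg i v z)(j := t) = swap_leg i v (z(j := t))" for t
      using \<open>i \<noteq> j\<close> by (auto simp: swap_leg_def)
    have up: "(upper_half j (swap_leg i v z))(j := t) = (upper_half j z)(j := t)" for t
      using False by (auto simp: swap_leg_def upper_half_def fun_eq_iff)
    show ?thesis
      by (simp only: partial_sum_Suc low up Suc.IH[OF \<open>j \<le> i\<close> \<open>i < d\<close> v])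
  next
    case True
    define v' where "v' = v - {j}"
    have v': "v' \<subseteq> {..<j}" and ins: "\<And>w. w \<subseteq> {..<j} \<Longrightarrow> insert j w = v \<longleftrightarrow> w = v'"
      using Suc.prems(3) True by (auto simp: v'_def less_Suc_eq)
    have low: "partial_sum j p ((swap_leg i v z)(j := t)) = partial_sum j p (z(j := t))" for t
      using True by (intro partial_sum_cong) (auto simp: swap_leg_def)
    have up: "partial_sum j False ((upper_half j (swap_leg i v z))(j := t)) =
        partial_sum j True ((upper_half j z)(j := t))" for t
    proof -
      have "partial_sum j False ((upper_half j (swap_leg i v z))(j := t)) =
          partial_sum j False (swap_leg i v' ((upper_half j z)(j := t)))"
        using \<open>i \<noteq> j\<close> ins v' by (intro partial_sum_cong) (auto simp: swap_leg_def upper_half_def)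
      then show ?thesis
        by (simp only: Suc.IH[OF \<open>j \<le> i\<close> \<open>i < d\<close> v'] not_False_eq_True)
    qed
    have "partial_sum (Suc j) p (swap_leg i v z) =
        (\<Sum>t\<in>?T. partial_sum j p (z(j := t)) * partial_sum j True ((upper_half j z)(j := t)))"
      by (simp only: partial_sum_Suc low up)
    also have "\<dots> = (\<Sum>t\<in>?T. partial_sum j (\<not> p) (z(j := t)) * partial_sum j False ((upper_half j z)(j := t)))"
      by (subst sum_swap_root)
         (simp only: swap_leg_update[symmetric] Suc.IH[OF order_refl \<open>j < d\<close> empty_subsetI] simp_thms)
    finally show ?thesis
      by (simp only: partial_sum_Suc)
  qed
qed

definition gap :: "nat \<Rightarrow> (nat \<Rightarrow> nat set \<Rightarrow> 'x) \<Rightarrow> int" where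
  "gap j z = partial_sum j False z - partial_sum j True z"

text \<open>
  Twisting both factors by a glued leg negates the gap of the lower one and replaces the untwisted
  upper factor by the twisted one.  The average of both expressions contains the gap of the upper
  factor.
\<close>

lemma gap_Suc:
  assumes "j < d"
  shows "2 * gap (Suc j) z =
    (\<Sum>t \<in> Pow {..<j} \<rightarrow>\<^sub>E X. gap j (z(j := t)) * gap j ((upper_half j z)(j := t)))"
proof -
  let ?T = "Pow {..<j} \<rightarrow>\<^sub>E X"
  let ?up = "\<lambda>b t. partial_sum j b ((upper_half j z)(j := t))"
  have 1: "gap (Suc j) z = (\<Sum>t\<in>?T. gap j (z(j := t)) * ?up False t)"
    by (simp add: gap_def partial_sum_Suc sum_subtractf left_diff_distrib)
  also have "\<dots> = (\<Sum>t\<in>?T. - gap j (z(j := t)) * ?up True t)"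
    by (subst sum_swap_root)
       (simp only: gap_def swap_leg_update[symmetric] minus_diff_eq
          partial_sum_swap_leg[OF order_refl assms empty_subsetI] simp_thms)
  finally show ?thesis
    unfolding mult_2 by (subst (1) 1) (simp add: sum.distrib[symmetric] gap_def algebra_simps)
qed

text \<open>
  Reflection positivity: if the open legs of both copies carry the same values, the gap for
  dimension \<open>j + 1\<close> is half a sum of squares of gaps for dimension \<open>j\<close>.
\<close>

lemma exists_gap_nonzero:
  assumes g: "\<And>i. g i \<in> X" "\<Phi> False g \<noteq> \<Phi> True g"
  shows "j \<le> d \<Longrightarrow> \<exists>z. (\<forall>i v. z i v \<in> X) \<and> gap j z \<noteq> 0"
proof (induction j)
  case 0
  then show ?case
    using g by (intro exI[of _ "\<lambda>i v. g i"]) (simp add: gap_def partial_sum_0)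
next
  case (Suc j)
  then obtain z where z: "\<And>i v. z i v \<in> X" "gap j z \<noteq> 0"
    by auto
  \<comment> \<open>Both copies get the values of \<open>z\<close> on their open legs.\<close>
  define z' where "z' = (\<lambda>i v. z i (v - {j}))"
  let ?T = "Pow {..<j} \<rightarrow>\<^sub>E X"
  have halves: "gap j (z'(j := t)) = gap j (z(j := t))"
    "gap j ((upper_half j z')(j := t)) = gap j (z(j := t))" for t
    unfolding gap_def
    by (intro arg_cong2[where f = minus] partial_sum_cong;
        force simp: z'_def upper_half_def intro: arg_cong[where f = "z _"])+
  have "2 * gap (Suc j) z' = (\<Sum>t\<in>?T. gap j (z(j := t)) * gap j (z(j := t)))"
    using gap_Suc[of j z'] Suc.prems by (simp only: halves Suc_le_eq)
  moreover have "\<dots> > 0"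
  proof (rule sum_pos2)
    show "finite ?T"
      by (simp add: finite_PiE finite_X)
    show "restrict (z j) (Pow {..<j}) \<in> ?T"
      using z(1) by simp
    have "gap j (z(j := restrict (z j) (Pow {..<j}))) = gap j z"
      unfolding gap_def by (intro arg_cong2[where f = minus] partial_sum_cong) auto
    with z(2) show "0 < gap j (z(j := restrict (z j) (Pow {..<j}))) * gap j (z(j := restrict (z j) (Pow {..<j})))"
      by (auto simp: zero_less_mult_iff linorder_neq_iff)
  qed simp
  moreover have "z' i v \<in> X" for i v
    using z(1) by (simp add: z'_def)
  ultimately show ?case
    by (metis less_irrefl mult_zero_right)
qed

text \<open>
  For \<open>j = d\<close> the subcube is the whole cube, and no open legs remain.
\<close>

lemma cube_sums_differ:
  assumes "\<And>i. g i \<in> X" "\<Phi> False g \<noteq> \<Phi> True g"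
  defines "cube_sum \<equiv> \<lambda>p. \<Sum>y \<in> cube_edges d \<rightarrow>\<^sub>E X. \<Prod>v \<in> Pow {..<d}. \<Phi> (p \<and> v = {}) (\<lambda>i. y (i, v - {i}))"
  shows "cube_sum False \<noteq> cube_sum True"
proof -
  obtain z where "gap d z \<noteq> 0"
    using exists_gap_nonzero[OF assms(1,2), of d] by auto
  moreover have "partial_sum d p z = cube_sum p" for p
    unfolding partial_sum_def cube_sum_def by (intro sum.cong prod.cong refl \<Phi>_cong) simp
  ultimately show ?thesis
    by (simp add: gap_def)
qed

end

section \<open>Homomorphisms from twisted graphs\<close>

definition common_nbrs :: "'f pair_pre_digraph \<Rightarrow> nat \<Rightarrow> (nat \<Rightarrow> 'f) \<Rightarrow> 'f set" where
  "common_nbrs F d f = {z \<in> pverts F. \<forall>i<d. (f i, z) \<in> parcs F}"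

text \<open>
  The number of ways to map the core vertices of parity \<open>p\<close> at one cube vertex, when the link \<open>q\<close> in
  direction \<open>i\<close> is mapped to \<open>g i q\<close>.
\<close>

definition core_tensor :: "'f pair_pre_digraph \<Rightarrow> nat \<Rightarrow> bool \<Rightarrow> (nat \<Rightarrow> bool \<Rightarrow> 'f) \<Rightarrow> int" where
  "core_tensor F d p g = (\<Prod>s \<in> core_patterns d p. int (card (common_nbrs F d (\<lambda>i. g i (i \<in> s)))))"

lemma graph_homs_cfi_iff:
  assumes "pair_graph F"
  shows "h \<in> graph_homs (cfi_graph d p) F \<longleftrightarrow> h \<in> links d \<union> cores d p \<rightarrow>\<^sub>E pverts F \<and>
    (\<forall>v s. Core v s \<in> cores d p \<longrightarrow> (\<forall>i<d. (h (Link i (v - {i}) (i \<in> s)), h (Core v s)) \<in> parcs F))"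
    (is "?L \<longleftrightarrow> ?R")
proof
  assume L: ?L
  have "(Link i (v - {i}) (i \<in> s), Core v s) \<in> parcs (cfi_graph d p)"
    if "Core v s \<in> cores d p" "i < d" for v s i
    using that by (auto simp: cfi_graph_def links_def cores_def cube_edges_def)
  moreover have "pverts (cfi_graph d p) = links d \<union> cores d p"
    by (simp add: cfi_graph_def)
  ultimately show ?R
    using L by (simp add: graph_homs_def)
next
  assume R: ?R
  have sym: "sym (parcs F)"
    using assms by (simp add: pair_graph_iff)
  have arc: "(h x, h y) \<in> parcs F"
    if "link_to_core x y" "x \<in> links d \<union> cores d p" "y \<in> links d \<union> cores d p" for x y
  proof -
    obtain i v s where "x = Link i (v - {i}) (i \<in> s)" "y = Core v s"
      using \<open>link_to_core x y\<close> by (cases x; cases y) auto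
    moreover from this have "i < d" "Core v s \<in> cores d p"
      using that(2,3) by (auto simp: links_def cores_def cube_edges_def)
    ultimately show ?thesis
      using R by blast
  qed
  have "(h x, h y) \<in> parcs F" if "(x, y) \<in> parcs (cfi_graph d p)" for x y
  proof -
    have "x \<in> links d \<union> cores d p" "y \<in> links d \<union> cores d p" "link_to_core x y \<or> link_to_core y x"
      using that by (auto simp: cfi_graph_def)
    then show ?thesis
      using arc[of x y] arc[of y x] symD[OF sym, of "h y" "h x"] by blast
  qed
  with R show ?L
    by (simp add: graph_homs_def cfi_graph_def)
qed

text \<open>
  Core vertices are adjacent to links only.  So a homomorphism is a map of the links together with,
  for every core vertex independently, a common neighbour of the images of the links it chooses.
\<close>

lemma hom_count_cfi_graph:
  assumes F: "pair_graph F"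
  shows "int (hom_count (cfi_graph d p) F) =
    (\<Sum>y \<in> cube_edges d \<rightarrow>\<^sub>E (UNIV \<rightarrow>\<^sub>E pverts F).
       \<Prod>v \<in> Pow {..<d}. core_tensor F d (p \<and> v = {}) (\<lambda>i. y (i, v - {i})))"
proof -
  let ?H = "graph_homs (cfi_graph d p) F" and ?X = "(UNIV :: bool set) \<rightarrow>\<^sub>E pverts F"
  let ?Y = "cube_edges d \<rightarrow>\<^sub>E ?X"
  have fin: "finite (pverts F)"
    using F by (simp add: pair_graph_iff)

  define link_part where "link_part h = (\<lambda>(i, w)\<in>cube_edges d. \<lambda>q. h (Link i w q) :: 'a)" for h
  define N where "N y x = (case x of Link i w q \<Rightarrow> {} |
      Core v s \<Rightarrow> common_nbrs F d (\<lambda>i. y (i, v - {i}) (i \<in> s)))" for y :: "nat \<times> nat set \<Rightarrow> bool \<Rightarrow> 'a" and x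
  define extend where "extend y k = (\<lambda>x\<in>links d \<union> cores d p.
      case x of Link i w q \<Rightarrow> y (i, w) q | Core v s \<Rightarrow> (k x :: 'a))" for y k
  have link_iff: "Link i w q \<in> links d \<longleftrightarrow> (i, w) \<in> cube_edges d"
    and not_core: "Link i w q \<notin> cores d p" and not_link: "Core v s \<notin> links d" for i w q v s
    by (auto simp: links_def cores_def)
  have core_edge: "(i, v - {i}) \<in> cube_edges d" if "Core v s \<in> cores d p" "i < d" for v s i
    using that by (auto simp: cores_def cube_edges_def)
  have "finite (links d \<union> cores d p \<rightarrow>\<^sub>E pverts F)"
    by (intro finite_PiE) (simp_all add: finite_links finite_cores fin)
  then have finH: "finite ?H"
    by (rule rev_finite_subset) (auto simp: graph_homs_cfi_iff[OF F])
  have finY: "finite ?Y"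
    by (intro finite_PiE finite_cube_edges) (simp_all add: fin)
  have part: "link_part ` ?H \<subseteq> ?Y"
  proof (rule image_subsetI)
    fix h assume "h \<in> ?H"
    then have "h x \<in> pverts F" if "x \<in> links d" for x
      using that by (auto simp: graph_homs_cfi_iff[OF F])
    then show "link_part h \<in> ?Y"
      using link_iff by (auto simp: link_part_def)
  qed
  have "hom_count (cfi_graph d p) F = (\<Sum>y\<in>?Y. card {h \<in> ?H. link_part h = y})"
    using sum.group[OF finH finY part, of "\<lambda>_. 1 :: nat"] by (simp add: hom_count_def)
  also have "\<dots> = (\<Sum>y\<in>?Y. card (\<Pi>\<^sub>E x\<in>cores d p. N y x))"
  proof (rule sum.cong[OF refl], rule bij_betw_same_card)
    fix y assume y: "y \<in> ?Y"
    show "bij_betw (\<lambda>h. restrict h (cores d p)) {h \<in> ?H. link_part h = y} (\<Pi>\<^sub>E x\<in>cores d p. N y x)"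
    proof (rule bij_betw_byWitness[where f' = "extend y"])
      show "\<forall>h\<in>{h \<in> ?H. link_part h = y}. extend y (restrict h (cores d p)) = h"
      proof (intro ballI ext)
        fix h x assume h: "h \<in> {h \<in> ?H. link_part h = y}"
        then have "h \<in> extensional (links d \<union> cores d p)"
          by (simp add: graph_homs_cfi_iff[OF F] PiE_def)
        moreover have "y (i, w) q = h (Link i w q)" if "(i, w) \<in> cube_edges d" for i w q
          using h that by (auto simp: link_part_def)
        ultimately show "extend y (restrict h (cores d p)) x = h x"
          by (cases x) (auto simp: extend_def link_iff not_core not_link extensional_def)
      qed
      show "\<forall>k\<in>\<Pi>\<^sub>E x\<in>cores d p. N y x. restrict (extend y k) (cores d p) = k"
      proof (intro ballI ext)
        fix k x assume "k \<in> (\<Pi>\<^sub>E x\<in>cores d p. N y x)"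
        then have "k \<in> extensional (cores d p)"
          by (simp add: PiE_def)
        then show "restrict (extend y k) (cores d p) x = k x"
          by (cases x) (auto simp: extend_def not_core extensional_def)
      qed
      show "(\<lambda>h. restrict h (cores d p)) ` {h \<in> ?H. link_part h = y} \<subseteq> (\<Pi>\<^sub>E x\<in>cores d p. N y x)"
      proof clarify
        fix h assume h: "h \<in> ?H" and y_eq: "y = link_part h"
        have "h x \<in> N (link_part h) x" if x: "x \<in> cores d p" for x
        proof (cases x)
          case (Link i w q)
          with x not_core show ?thesis by simp
        next
          case (Core v s)
          with x h have "(h (Link i (v - {i}) (i \<in> s)), h (Core v s)) \<in> parcs F" if "i < d" for i
            using that by (simp add: graph_homs_cfi_iff[OF F])
          moreover have "h (Core v s) \<in> pverts F"
            using x h Core by (auto simp: graph_homs_cfi_iff[OF F])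
          ultimately show ?thesis
            using Core x core_edge by (simp add: N_def common_nbrs_def link_part_def)
        qed
        then show "restrict h (cores d p) \<in> (\<Pi>\<^sub>E x\<in>cores d p. N (link_part h) x)"
          by simp
      qed
      show "extend y ` (\<Pi>\<^sub>E x\<in>cores d p. N y x) \<subseteq> {h \<in> ?H. link_part h = y}"
      proof clarify
        fix k assume k: "k \<in> (\<Pi>\<^sub>E x\<in>cores d p. N y x)"
        have k_core: "k (Core v s) \<in> common_nbrs F d (\<lambda>i. y (i, v - {i}) (i \<in> s))"
          if "Core v s \<in> cores d p" for v s
          using PiE_mem[OF k that] by (simp add: N_def)
        have y_mem: "y e q \<in> pverts F" if "e \<in> cube_edges d" for e q
          using PiE_mem[OF PiE_mem[OF y that], of q] by simp
        have "extend y k x \<in> pverts F" if "x \<in> links d \<union> cores d p" for x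
          using that y_mem k_core
          by (cases x) (auto simp: extend_def link_iff not_core not_link common_nbrs_def)
        then have "extend y k \<in> links d \<union> cores d p \<rightarrow>\<^sub>E pverts F"
          by (auto simp: extend_def)
        moreover have "(extend y k (Link i (v - {i}) (i \<in> s)), extend y k (Core v s)) \<in> parcs F"
          if "Core v s \<in> cores d p" "i < d" for v s i
          using k_core[OF that(1)] that core_edge[OF that]
          by (simp add: extend_def link_iff common_nbrs_def)
        ultimately have "extend y k \<in> ?H"
          by (simp add: graph_homs_cfi_iff[OF F])
        moreover have "link_part (extend y k) = y"
        proof
          fix e :: "nat \<times> nat set"
          obtain i w where "e = (i, w)" by force
          with y show "link_part (extend y k) e = y e"
            by (cases "e \<in> cube_edges d") (auto simp: link_part_def extend_def link_iff)
        qed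
        ultimately show "extend y k \<in> ?H \<and> link_part (extend y k) = y"
          by simp
      qed
    qed
  qed
  finally have "int (hom_count (cfi_graph d p) F) = (\<Sum>y\<in>?Y. \<Prod>x\<in>cores d p. int (card (N y x)))"
    by (simp add: card_PiE finite_cores)
  also have "\<dots> = (\<Sum>y\<in>?Y. \<Prod>v\<in>Pow {..<d}. core_tensor F d (p \<and> v = {}) (\<lambda>i. y (i, v - {i})))"
  proof (rule sum.cong[OF refl])
    fix y
    have "inj_on (\<lambda>(v, s). Core v s) A" for A
      by (auto simp: inj_on_def)
    then have "(\<Prod>x\<in>cores d p. int (card (N y x))) =
        (\<Prod>(v, s)\<in>(SIGMA v : Pow {..<d}. core_patterns d (p \<and> v = {})). int (card (N y (Core v s))))"
      unfolding cores_eq_image by (subst prod.reindex) (auto simp: case_prod_beta)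
    also have "\<dots> = (\<Prod>v\<in>Pow {..<d}. \<Prod>s\<in>core_patterns d (p \<and> v = {}). int (card (N y (Core v s))))"
      by (subst prod.Sigma) (auto simp: finite_core_patterns)
    finally show "(\<Prod>x\<in>cores d p. int (card (N y x))) =
        (\<Prod>v\<in>Pow {..<d}. core_tensor F d (p \<and> v = {}) (\<lambda>i. y (i, v - {i})))"
      by (simp add: core_tensor_def N_def)
  qed
  finally show ?thesis .
qed

lemma xor_core_patterns:
  assumes "i < d" "s \<in> core_patterns d p"
  shows "{j. (j \<in> s) \<noteq> (j = i)} \<in> core_patterns d (\<not> p)"
proof -
  have "odd (card {j. (j \<in> s) \<noteq> (j \<in> {i})}) \<longleftrightarrow> odd (card s) \<noteq> odd (card {i})"
    using assms by (intro odd_card_xor) (auto simp: core_patterns_def intro: finite_subset)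
  with assms show ?thesis
    by (auto simp: core_patterns_def)
qed

lemma xor_xor: "{j. (j \<in> {j. (j \<in> s) \<noteq> (j = i)}) \<noteq> (j = i)} = s"
  by auto

text \<open>
  Changing the choice in one fixed direction exchanges the even and the odd patterns.
\<close>

lemma card_core_patterns_eq:
  assumes "0 < d"
  shows "card (core_patterns d False) = card (core_patterns d True)"
proof (rule bij_betw_same_card)
  let ?f = "\<lambda>s. {j. (j \<in> s) \<noteq> (j = (0::nat))}"
  show "bij_betw ?f (core_patterns d False) (core_patterns d True)"
    by (rule bij_betw_byWitness[where f' = ?f])
       (use xor_core_patterns[OF assms, of _ False] xor_core_patterns[OF assms, of _ True] xor_xor in auto)
qed

lemma core_tensor_twisted:
  assumes "pair_graph F"
  shows "twisted_tensor d (UNIV \<rightarrow>\<^sub>E pverts F) (\<lambda>x. x \<circ> Not) (core_tensor F d)"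
proof
  show "finite ((UNIV :: bool set) \<rightarrow>\<^sub>E pverts F)"
    using assms by (intro finite_PiE) (auto simp: pair_graph_iff)
  show "x \<circ> Not \<in> UNIV \<rightarrow>\<^sub>E pverts F" if "x \<in> UNIV \<rightarrow>\<^sub>E pverts F" for x
    using that by (auto simp: PiE_UNIV_domain)
  show "x \<circ> Not \<circ> Not = x" for x :: "bool \<Rightarrow> 'a"
    by auto
  show "core_tensor F d p g = core_tensor F d p g'" if "\<And>i. i < d \<Longrightarrow> g i = g' i" for g g' p
    using that by (simp add: core_tensor_def common_nbrs_def)
  show "core_tensor F d p (g(i := g i \<circ> Not)) = core_tensor F d (\<not> p) g" if "i < d" for i p g
    unfolding core_tensor_def
  proof (rule prod.reindex_bij_witness[where i = "\<lambda>s. {j. (j \<in> s) \<noteq> (j = i)}" and j = "\<lambda>s. {j. (j \<in> s) \<noteq> (j = i)}"])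
    fix s assume s: "s \<in> core_patterns d p"
    show "{j. (j \<in> s) \<noteq> (j = i)} \<in> core_patterns d (\<not> p)"
      by (rule xor_core_patterns[OF that s])
    have "(\<lambda>j. g j (j \<in> {j. (j \<in> s) \<noteq> (j = i)})) = (\<lambda>j. (g(i := g i \<circ> Not)) j (j \<in> s))"
      by auto
    then show "int (card (common_nbrs F d (\<lambda>j. g j (j \<in> {j. (j \<in> s) \<noteq> (j = i)})))) =
        int (card (common_nbrs F d (\<lambda>j. (g(i := g i \<circ> Not)) j (j \<in> s))))"
      by simp
  next
    fix s assume "s \<in> core_patterns d (\<not> p)"
    from xor_core_patterns[OF that this] show "{j. (j \<in> s) \<noteq> (j = i)} \<in> core_patterns d p"
      by simp
  qed (simp_all only: xor_xor)
qed

text \<open>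
  A pattern \<open>s\<close> other than \<open>{}\<close> and \<open>{..<d}\<close> chooses both \<open>a\<close> and \<open>b\<close>, and contributes the factor
  \<open>m = |N(a) \<inter> N(b)|\<close>, which is positive because of \<open>c\<close>.  The two exceptional patterns are both even and together
  contribute \<open>|N(a)| |N(b)| > m\<^sup>2\<close> to the even product only.
\<close>

lemma core_tensor_parities_differ:
  assumes F: "pair_graph F" and d: "even d" "0 < d"
    and c: "(a, c) \<in> parcs F" "(b, c) \<in> parcs F"
    and ne: "{z. (a, z) \<in> parcs F} \<noteq> {z. (b, z) \<in> parcs F}"
  shows "core_tensor F d False (\<lambda>i q. if q then b else a) \<noteq> core_tensor F d True (\<lambda>i q. if q then b else a)"
proof -
  let ?A = "{z. (a, z) \<in> parcs F}" and ?B = "{z. (b, z) \<in> parcs F}"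
  let ?E = "core_patterns d False" and ?O = "core_patterns d True"
  let ?n = "\<lambda>s. int (card (common_nbrs F d (\<lambda>i. if i \<in> s then b else a)))"
  let ?m = "int (card (?A \<inter> ?B))"
  have sub: "?A \<subseteq> pverts F" "?B \<subseteq> pverts F"
    using F by (auto simp: pair_graph_iff)
  moreover have "finite (pverts F)"
    using F by (simp add: pair_graph_iff)
  ultimately have fin: "finite ?A" "finite ?B"
    using finite_subset by blast+
  have nA: "?n {} = int (card ?A)"
    using sub d(2) by (auto simp: common_nbrs_def intro!: arg_cong[where f = card])
  have nB: "?n {..<d} = int (card ?B)"
    using sub d(2) by (auto simp: common_nbrs_def intro!: arg_cong[where f = card])
  have n: "?n s = ?m" if "s \<subseteq> {..<d}" "s \<noteq> {}" "s \<noteq> {..<d}" for s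
  proof -
    obtain i where "i \<in> s"
      using \<open>s \<noteq> {}\<close> by blast
    moreover from this have "i < d"
      using \<open>s \<subseteq> {..<d}\<close> by blast
    moreover obtain j where "j < d" "j \<notin> s"
      using \<open>s \<subseteq> {..<d}\<close> \<open>s \<noteq> {..<d}\<close> by blast
    ultimately have "common_nbrs F d (\<lambda>i. if i \<in> s then b else a) = ?A \<inter> ?B"
      using sub by (auto simp: common_nbrs_def split: if_splits)
    then show ?thesis by simp
  qed
  have E: "{} \<in> ?E" "{..<d} \<in> ?E - {{}}"
    using d by (auto simp: core_patterns_def)
  have finE: "finite ?E"
    by (rule finite_core_patterns)
  have "prod ?n ?E = ?n {} * (?n {..<d} * prod ?n (?E - {{}} - {{..<d}}))"
    using E finE by (simp only: prod.remove[of ?E "{}"] prod.remove[of "?E - {{}}" "{..<d}"] finite_Diff)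
  also have "prod ?n (?E - {{}} - {{..<d}}) = (\<Prod>s\<in>?E - {{}} - {{..<d}}. ?m)"
    by (intro prod.cong refl n) (auto simp: core_patterns_def)
  also have "\<dots> = ?m ^ (card ?E - 2)"
    using E finE by (simp add: card_Diff_singleton numeral_2_eq_2)
  finally have even_prod: "prod ?n ?E = int (card ?A) * int (card ?B) * ?m ^ (card ?E - 2)"
    by (simp only: nA nB mult.assoc)
  have "prod ?n ?O = (\<Prod>s\<in>?O. ?m)"
    using d(1) by (intro prod.cong refl n) (auto simp: core_patterns_def)
  also have "\<dots> = ?m ^ card ?E"
    by (simp add: card_core_patterns_eq[OF d(2)])
  also have "card ?E = Suc (Suc (card ?E - 2))"
  proof -
    have "card {{}, {..<d}} \<le> card ?E"
      using E finE by (intro card_mono) auto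
    moreover have "{} \<noteq> {..<d}"
      using d(2) by auto
    then have "card {{}, {..<d}} = 2"
      unfolding card_2_iff by blast
    ultimately show ?thesis by simp
  qed
  finally have odd_prod: "prod ?n ?O = ?m * ?m * ?m ^ (card ?E - 2)"
    by simp
  have "c \<in> ?A \<inter> ?B"
    using c by simp
  then have "?m > 0"
    using fin by (auto simp: card_gt_0_iff)
  have le: "?m \<le> int (card ?A)" "?m \<le> int (card ?B)"
    using fin by (auto intro: card_mono)
  have "?m * ?m < int (card ?A) * int (card ?B)"
  proof (cases "?m < int (card ?A)")
    case True
    with le \<open>?m > 0\<close> show ?thesis
      by (intro mult_less_le_imp_less) auto
  next
    case False
    then have "?A \<inter> ?B = ?A"
      using le fin by (intro card_subset_eq) auto
    then have "?A \<subset> ?B"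
      using ne by blast
    then have "?m < int (card ?B)"
      using fin \<open>?A \<inter> ?B = ?A\<close> by (simp add: psubset_card_mono)
    with le \<open>?m > 0\<close> show ?thesis
      by (intro mult_le_less_imp_less) auto
  qed
  then have "prod ?n ?O < prod ?n ?E"
    unfolding even_prod odd_prod using \<open>?m > 0\<close> by (intro mult_strict_right_mono) auto
  then show ?thesis
    by (simp add: core_tensor_def)
qed

lemma hom_count_cfi_graphs_differ:
  assumes F: "pair_graph F" and d: "even d" "0 < d"
    and c: "(a, c) \<in> parcs F" "(b, c) \<in> parcs F"
    and ne: "{z. (a, z) \<in> parcs F} \<noteq> {z. (b, z) \<in> parcs F}"
  shows "hom_count (cfi_graph d False) F \<noteq> hom_count (cfi_graph d True) F"
proof -
  interpret twisted_tensor d "UNIV \<rightarrow>\<^sub>E pverts F" "\<lambda>x. x \<circ> Not" "core_tensor F d"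
    by (rule core_tensor_twisted[OF F])
  have "a \<in> pverts F" "b \<in> pverts F"
    using F c by (auto simp: pair_graph_iff)
  then have "(\<lambda>q. if q then b else a) \<in> UNIV \<rightarrow>\<^sub>E pverts F"
    by (auto simp: PiE_UNIV_domain)
  from cube_sums_differ[OF this core_tensor_parities_differ[OF F d c ne]]
  have "int (hom_count (cfi_graph d False) F) \<noteq> int (hom_count (cfi_graph d True) F)"
    unfolding hom_count_cfi_graph[OF F] .
  then show ?thesis
    by simp
qed

lemma exists_C_equiv_graphs_hom_count_differ:
  obtains G H :: "nat pair_pre_digraph" where "G \<in> graphs" "H \<in> graphs" "C_equiv k G H"
    "\<And>F :: 'b pair_pre_digraph. \<And>a b c. pair_graph F \<Longrightarrow> (a, c) \<in> parcs F \<Longrightarrow> (b, c) \<in> parcs F \<Longrightarrow>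
       {z. (a, z) \<in> parcs F} \<noteq> {z. (b, z) \<in> parcs F} \<Longrightarrow> hom_count G F \<noteq> hom_count H F"
proof -
  \<comment> \<open>An even dimension that is at least \<open>k\<close>, and positive also for \<open>k = 0\<close>.\<close>
  define d where "d = 2 * Suc k"
  let ?X = "cfi_graph d"
  have "finite (pverts (?X False) \<union> pverts (?X True))"
    using pair_graph_cfi_graph by (auto simp: pair_graph_iff)
  from finite_imp_inj_to_nat_seg[OF this]
  obtain f :: "cfi_vertex \<Rightarrow> nat" where "inj_on f (pverts (?X False) \<union> pverts (?X True))"
    by auto
  then have inj: "inj_on f (pverts (?X p))" for p
    by (cases p) (auto intro: inj_on_subset)
  have sub: "parcs (?X p) \<subseteq> pverts (?X p) \<times> pverts (?X p)" for p
    using pair_graph_cfi_graph by (auto simp: pair_graph_iff)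
  show thesis
  proof
    show "rename_graph f (?X False) \<in> graphs" "rename_graph f (?X True) \<in> graphs"
      using pair_graph_rename_graph[OF inj pair_graph_cfi_graph] by (auto simp: graphs_def)
    show "C_equiv k (rename_graph f (?X False)) (rename_graph f (?X True))"
      using C_equiv_rename_graph[OF inj sub, of k False] C_equiv_rename_graph[OF inj sub, of k True]
        cfi_graphs_C_equiv[of k d]
      by (simp add: C_equiv_def d_def)
    show "hom_count (rename_graph f (?X False)) F \<noteq> hom_count (rename_graph f (?X True)) F"
      if "pair_graph F" "(a, c) \<in> parcs F" "(b, c) \<in> parcs F"
        "{z. (a, z) \<in> parcs F} \<noteq> {z. (b, z) \<in> parcs F}" for F :: "'b pair_pre_digraph" and a b c
      unfolding hom_count_rename_graph[OF inj sub]
      using hom_count_cfi_graphs_differ[OF that(1) _ _ that(2-4)] by (simp add: d_def)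
  qed
qed

section \<open>Right profiles cannot express the equivalence\<close>

theorem theorem10:
  fixes R :: "nat pair_pre_digraph rel" and k :: nat
  assumes "equiv graphs R"
    and "\<And>G H. G \<in> graphs \<Longrightarrow> H \<in> graphs \<Longrightarrow> (G, H) \<in> R \<Longrightarrow> C_equiv 1 G H"
    and "k \<ge> 2"
    and "\<And>G H. G \<in> graphs \<Longrightarrow> H \<in> graphs \<Longrightarrow> C_equiv k G H \<Longrightarrow> (G, H) \<in> R"
  shows "\<not> (\<exists>\<F>. graph_class \<F> \<and>
    (\<forall>G \<in> graphs. \<forall>H \<in> graphs. (G, H) \<in> R \<longleftrightarrow> same_right_profile \<F> G H))"
proof (rule notI, elim exE conjE)
  fix \<F>
  assume \<F>: "graph_class \<F>"
    and profile: "\<forall>G \<in> graphs. \<forall>H \<in> graphs. (G, H) \<in> R \<longleftrightarrow> same_right_profile \<F> G H"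
  have graph: "pair_graph F" if "F \<in> \<F>" for F
    using \<F> that by (auto simp: graph_class_def graphs_def)
  have "\<exists>F\<in>\<F>. \<exists>a b c. (a, c) \<in> parcs F \<and> (b, c) \<in> parcs F \<and>
      {z. (a, z) \<in> parcs F} \<noteq> {z. (b, z) \<in> parcs F}"
  proof (rule ccontr)
    assume no: "\<not> ?thesis"
    have "hom_count (complete_graph n) F = 0" if "F \<in> \<F>" "n \<ge> 3" for F n
      using no that by (intro no_hom_from_complete_graph graph) blast+
    then have "same_right_profile \<F> (complete_graph 3) (complete_graph 4)"
      by (simp add: same_right_profile_def)
    with profile complete_graph_in_graphs have "(complete_graph 3, complete_graph 4) \<in> R"
      by blast
    with assms(2) complete_graph_in_graphs complete_graphs_not_C_equiv[of 3 4] show False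
      by auto
  qed
  then obtain F a b c where F: "F \<in> \<F>" "(a, c) \<in> parcs F" "(b, c) \<in> parcs F"
      "{z. (a, z) \<in> parcs F} \<noteq> {z. (b, z) \<in> parcs F}"
    by blast
  obtain G H :: "nat pair_pre_digraph" where GH: "G \<in> graphs" "H \<in> graphs" "C_equiv k G H"
      "hom_count G F \<noteq> hom_count H F"
    using exists_C_equiv_graphs_hom_count_differ[of k] F graph by metis
  then have "same_right_profile \<F> G H"
    using assms(4) profile by blast
  with F(1) GH(4) show False
    by (simp add: same_right_profile_def)
qed

end
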